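(* Let $N\geq 3$ be an integer and $k\in\{1,2,\ldots,N\}$. Let $p,q:[0,\infty)\to(0,\infty)$ and $f,g:[0,\infty)\times[0,\infty)\to[0,\infty)$ be continuous functions such that $f,g$ are monotone non-decreasing in each variable, $f(0,0)=g(0,0)=0$, $f(s,t)>0$ and $g(s,t)>0$ for all $s,t>0$, and $$\int_{1}^{\infty}\frac{1}{\sqrt[k+1]{(k+1)F(t)}}\,dt=\infty,\qquad F(t)=\int_{0}^{t}\left(f^{k}(z,z)+g^{k}(z,z)\right)dz.$$ Consider the system $$\begin{cases}S_{k}^{1/k}\left(\lambda\left(D^{2}u\right)\right)=p(|x|)\,f(u,v)&\text{in }\mathbb{R}^{N},\\ S_{k}^{1/k}\left(\lambda\left(D^{2}v\right)\right)=q(|x|)\,g(u,v)&\text{in }\mathbb{R}^{N}.\end{cases}\qquad( * )$$ (a) The system $( * )$ has a nonnegative nontrivial entire radial solution $(u,v)\in\Phi^{k}(\mathbb{R}^{N})\times\Phi^{k}(\mathbb{R}^{N})$. Suppose furthermore that $r^{N+\frac{N}{k}-2}\left[p^{k}(r)+q^{k}(r)\right]$ is nondecreasing for large $r$. Then: (b) If $p$ and $q$ satisfy $$\int_{0}^{\infty}\left(\frac{k}{t^{N-k}}\int_{0}^{t}\frac{s^{N-1}}{C_{N-1}^{k-1}}p^{k}(s)\,ds\right)^{1/k}dt=\infty\quad\text{and}\quad\int_{0}^{\infty}\left(\frac{k}{t^{N-k}}\int_{0}^{t}\frac{s^{N-1}}{C_{N-1}^{k-1}}q^{k}(s)\,ds\right)^{1/k}dt=\infty,$$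 then any nonnegative nontrivial radial solution $(u,v)\in\Phi^{k}(\mathbb{R}^{N})\times\Phi^{k}(\mathbb{R}^{N})$ of $( * )$ is large. (c) Conversely, if $( * )$ has a nonnegative entire large radial solution $(u,v)\in\Phi^{k}(\mathbb{R}^{N})\times\Phi^{k}(\mathbb{R}^{N})$, then one or both of the following hold: 1. $\displaystyle\int_{0}^{\infty}t^{1+\varepsilon+\frac{2(k-1)}{k+1}}\left(p^{k}(t)+q^{k}(t)\right)^{\frac{2}{k+1}}dt=\infty$ for every $\varepsilon>0$; 2. $k\in\{[N/2]+1,\ldots,N\}$ if $N$ is odd, or $k\in\{[N/2],\ldots,N\}$ if $N$ is even.
   Context: $[\cdot]$ denotes the integer part and $C_{N-1}^{k-1}=\frac{(N-1)!}{(k-1)!(N-k)!}$. For a $C^{2}$ function $u$ on $\mathbb{R}^{N}$, $D^{2}u$ is its Hessian matrix and $\lambda(D^{2}u)=(\lambda_{1},\ldots,\lambda_{N})$ is the vector of eigenvalues of $D^{2}u$. For $j=1,\ldots,N$, $S_{j}(\lambda)=\sum_{1\leq i_{1}<\cdots<i_{j}\leq N}\lambda_{i_{1}}\cdots\lambda_{i_{j}}$ is the $j$-th elementary symmetric polynomial, and $S_{k}^{1/k}$ denotes $(S_k)^{1/k}$. The Gårding open cone is $\Gamma_{k}(N)=\{\lambda\in\mathbb{R}^{N} : S_{1}(\lambda)>0,\ldots,S_{k}(\lambda)>0\}$, and the space of admissible (strictly $k$-convex) functions is $\Phi^{k}(\mathbb{R}^{N})=\{u\in C^{2}(\mathbb{R}^{N})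 : \lambda(D^{2}u(x))\in\Gamma_{k}(N)\text{ for all }x\in\mathbb{R}^{N}\}$. "Nondecreasing for large $r$" means nondecreasing on $[R,\infty)$ for some $R>0$. A pair $(u,v)$ is radial or nonnegative if both components are (radial: depending only on $|x|$); "entire" means defined on all of $\mathbb{R}^{N}$; "nontrivial" means $(u,v)\not\equiv(0,0)$; $(u,v)$ is "large" if $u(x)\to\infty$ and $v(x)\to\infty$ as $|x|\to\infty$. *)

theory Defs
  imports "HOL-Analysis.Analysis"
begin

definition partial_deriv :: "'n::finite \<Rightarrow> (real ^ 'n \<Rightarrow> real) \<Rightarrow> real ^ 'n \<Rightarrow> real" where
  "partial_deriv i u x = frechet_derivative u (at x) (axis i 1)"

text \<open>Differentiability of \<open>u\<close> and of its first partial derivatives is part of the definition of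
  \<open>C2\<close>, so \<^const>\<open>frechet_derivative\<close> is never applied outside its domain for such \<open>u\<close>.\<close>

definition C2 :: "(real ^ 'n::finite \<Rightarrow> real) set" where
  "C2 = {u. (\<forall>x. u differentiable (at x)) \<and>
            (\<forall>i x. partial_deriv i u differentiable (at x)) \<and>
            (\<forall>i j. continuous_on UNIV (partial_deriv i (partial_deriv j u)))}"

definition hessian :: "(real ^ 'n::finite \<Rightarrow> real) \<Rightarrow> real ^ 'n \<Rightarrow> real ^ 'n ^ 'n" where
  "hessian u x = (\<chi> i j. partial_deriv i (partial_deriv j u) x)"

text \<open>The vector of eigenvalues, repeated according to multiplicity, is a vector whose entries are
  the roots of the characteristic polynomial. It exists for every symmetric real matrix (in
  particular for the Hessian of a \<open>C2\<close> function) and is unique up to a permutation of the entries;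
  it is used only inside symmetric functions, so the choice of the ordering is immaterial.\<close>

definition eigenvalue_vector :: "real ^ 'n ^ 'n::finite \<Rightarrow> real ^ 'n" where
  "eigenvalue_vector A = (SOME l. \<forall>t. det (mat t - A) = (\<Prod>i\<in>UNIV. t - l $ i))"

definition elem_sym :: "nat \<Rightarrow> real ^ 'n::finite \<Rightarrow> real" where
  "elem_sym j l = (\<Sum>I | I \<subseteq> UNIV \<and> card I = j. \<Prod>i\<in>I. l $ i)"

definition Garding_cone :: "nat \<Rightarrow> (real ^ 'n::finite) set" where
  "Garding_cone k = {l. \<forall>j\<in>{1..k}. elem_sym j l > 0}"

definition admissible :: "nat \<Rightarrow> (real ^ 'n::finite \<Rightarrow> real) set" where
  "admissible k = {u \<in> C2. \<forall>x. eigenvalue_vector (hessian u x) \<in> Garding_cone k}"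

definition radial :: "('a::real_normed_vector \<Rightarrow> real) \<Rightarrow> bool" where
  "radial u \<longleftrightarrow> (\<forall>x y. norm x = norm y \<longrightarrow> u x = u y)"

definition hessian_system ::
  "nat \<Rightarrow> (real \<Rightarrow> real) \<Rightarrow> (real \<Rightarrow> real) \<Rightarrow> (real \<Rightarrow> real \<Rightarrow> real) \<Rightarrow> (real \<Rightarrow> real \<Rightarrow> real) \<Rightarrow>
     (real ^ 'n::finite \<Rightarrow> real) \<Rightarrow> (real ^ 'n \<Rightarrow> real) \<Rightarrow> bool" where
  "hessian_system k p q f g u v \<longleftrightarrow>
     (\<forall>x. root k (elem_sym k (eigenvalue_vector (hessian u x))) = p (norm x) * f (u x) (v x)) \<and>
     (\<forall>x. root k (elem_sym k (eigenvalue_vector (hessian v x))) = q (norm x) * g (u x) (v x))"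

text \<open>\<open>f\<close> and \<open>g\<close> are only constrained on the closed quadrant, hence the nonnegativity of
  \<open>u\<close> and \<open>v\<close> also makes the system meaningful.\<close>

definition nonneg_radial_solution ::
  "nat \<Rightarrow> (real \<Rightarrow> real) \<Rightarrow> (real \<Rightarrow> real) \<Rightarrow> (real \<Rightarrow> real \<Rightarrow> real) \<Rightarrow> (real \<Rightarrow> real \<Rightarrow> real) \<Rightarrow>
     (real ^ 'n::finite \<Rightarrow> real) \<Rightarrow> (real ^ 'n \<Rightarrow> real) \<Rightarrow> bool" where
  "nonneg_radial_solution k p q f g u v \<longleftrightarrow>
     u \<in> admissible k \<and> v \<in> admissible k \<and>
     (\<forall>x. u x \<ge> 0) \<and> (\<forall>x. v x \<ge> 0) \<and> radial u \<and> radial v \<and>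
     hessian_system k p q f g u v"

definition nontrivial :: "('a \<Rightarrow> real) \<Rightarrow> ('a \<Rightarrow> real) \<Rightarrow> bool" where
  "nontrivial u v \<longleftrightarrow> \<not> (\<forall>x. u x = 0 \<and> v x = 0)"

definition large :: "('a::real_normed_vector \<Rightarrow> real) \<Rightarrow> ('a \<Rightarrow> real) \<Rightarrow> bool" where
  "large u v \<longleftrightarrow> filterlim u at_top at_infinity \<and> filterlim v at_top at_infinity"

definition nonlinearity :: "(real \<Rightarrow> real \<Rightarrow> real) \<Rightarrow> bool" where
  "nonlinearity f \<longleftrightarrow>
     continuous_on ({0..} \<times> {0..}) (\<lambda>(s, t). f s t) \<and>
     (\<forall>s\<ge>0. \<forall>t\<ge>0. f s t \<ge> 0) \<and>
     (\<forall>t\<ge>0. mono_on {0..} (\<lambda>s. f s t)) \<and>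
     (\<forall>s\<ge>0. mono_on {0..} (\<lambda>t. f s t)) \<and>
     f 0 0 = 0 \<and>
     (\<forall>s>0. \<forall>t>0. f s t > 0)"

definition primitive_F ::
  "nat \<Rightarrow> (real \<Rightarrow> real \<Rightarrow> real) \<Rightarrow> (real \<Rightarrow> real \<Rightarrow> real) \<Rightarrow> real \<Rightarrow> real" where
  "primitive_F k f g t = integral {0..t} (\<lambda>z. f z z ^ k + g z z ^ k)"

text \<open>Improper integrals of nonnegative functions are taken as Lebesgue integrals with values
  in \<open>[0, \<infinity>]\<close>; divergence means that the value is \<open>\<infinity>\<close>.\<close>

definition keller_osserman_integral ::
  "nat \<Rightarrow> (real \<Rightarrow> real \<Rightarrow> real) \<Rightarrow> (real \<Rightarrow> real \<Rightarrow> real) \<Rightarrow> ennreal" where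
  "keller_osserman_integral k f g =
     (\<integral>\<^sup>+ t \<in> {1..}. ennreal (1 / root (k + 1) (real (k + 1) * primitive_F k f g t)) \<partial>lborel)"

definition weight_integral :: "nat \<Rightarrow> nat \<Rightarrow> (real \<Rightarrow> real) \<Rightarrow> ennreal" where
  "weight_integral N k p =
     (\<integral>\<^sup>+ t \<in> {0..}. ennreal (root k (real k / t ^ (N - k) *
        integral {0..t} (\<lambda>s. s ^ (N - 1) / real ((N - 1) choose (k - 1)) * p s ^ k))) \<partial>lborel)"

end

theory Submission
  imports Defs
begin

text \<open>
  For \<open>u x = \<phi> \<bar>x\<bar>\<close> the Hessian has the eigenvalues \<open>\<phi>''\<close> (once) and \<open>\<phi>' / r\<close> (\<open>N - 1\<close> times), and
  \<open>S\<^sub>k\<close> becomes \<open>C / (k r\<^bsup>N-1\<^esup>) (r\<^bsup>N-k\<^esup> \<phi>'\<^bsup>k\<^esup>)'\<close> with \<open>C = (N - 1) choose (k - 1)\<close>. Hence the system is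
  equivalent to \<open>\<phi>' = r a\<close>, where \<open>a\<^sup>k\<close> is \<open>k / C\<close> times a weighted average over \<open>[0, r]\<close> of the
  right-hand side. Solutions are built by monotone iteration of this integral system, starting
  from the constant 1. The a priori bound comes from multiplying by \<open>\<phi>'\<close>: it gives
  \<open>\<phi>'\<^bsup>k+1\<^esup> \<le> B F(u + v)\<close> on bounded intervals, so that \<open>\<integral> dt / F\<^bsup>1/(k+1)\<^esup>\<close> along the solution is
  bounded, and the divergence of this integral excludes blow-up. For a large solution the same
  computation for \<open>r\<^bsup>N/k-1\<^esup> \<phi>'\<close> together with the monotonicity of \<open>r\<^bsup>N+N/k-2\<^esup> (p\<^sup>k + q\<^sup>k)\<close> leads to
  \<open>(u + v)' \<le> \<theta> F(u + v)\<^bsup>1/(k+1)\<^esup>\<close>, where by AM-GM \<open>\<theta>\<close> is integrable at infinity if \<open>2 k < N\<close> and the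
  integral in the first alternative converges; then \<open>u + v\<close> would be bounded.
\<close>

section \<open>Eigenvalues of rank-one perturbations of scalar matrices\<close>

text \<open>Put \<open>w = r^(N/k-1) \<phi>'\<close>. Then \<open>w^k\<close> is the quantity under
  the derivative in the divergence form of \<open>S_k\<close>, and multiplying that form by
  \<open>w\<close> gives \<open>(w^(k+1))' = (k+1)/C r^(N+N/k-2) h \<phi>'\<close> with
  \<open>h = S_k\<close>. This is where both the exponent \<open>N/k-1\<close> and the power of
  \<open>r\<close> in the monotonicity hypothesis come from: a nondecreasing factor may be replaced
  by its value at the right endpoint, and what remains integrates to \<open>F(u + v)\<close>. The
  weight 1 yields only an inequality, but one that bounds \<open>\<phi>'\<close> itself down to the
  origin. The other delicate point is the origin. A constructed solution starts from 1, so its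
  source is positive, the k-th root is differentiable and \<open>\<phi>'' - \<phi>'/r\<close> tends
  to 0. A given solution may have a component that vanishes at the origin, where \<open>f\<close>
  and \<open>g\<close> need not be positive; positivity of its source is read off from admissibility
  instead.\<close>

lemma prod_one_plus_eq_elem_sym:
  fixes l :: "real ^ 'n::finite"
  shows "(\<Prod>i\<in>UNIV. 1 + s * l $ i) = (\<Sum>j\<le>CARD('n). elem_sym j l * s ^ j)"
proof -
  have "(\<Prod>i\<in>UNIV. 1 + s * l $ i) = (\<Prod>i\<in>UNIV. s * l $ i + 1)"
    by (simp add: add.commute)
  also have "\<dots> = (\<Sum>I\<in>Pow UNIV. \<Prod>i\<in>I. s * l $ i)"
    by (subst prod_add) auto
  also have "\<dots> = (\<Sum>j\<le>CARD('n). \<Sum>I | I \<in> Pow UNIV \<and> card I = j. \<Prod>i\<in>I. s * l $ i)"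
    by (rule sum.group [symmetric]) (auto intro: card_mono)
  also have "\<dots> = (\<Sum>j\<le>CARD('n). elem_sym j l * s ^ j)"
    unfolding elem_sym_def sum_distrib_right
    by (intro sum.cong) (auto simp: prod.distrib mult.commute)
  finally show ?thesis .
qed

text \<open>For a radial function this is the Hessian at \<open>x\<close>: \<open>e\<close> is the
  direction of \<open>x\<close>, \<open>\<alpha> = \<phi>' / r\<close> and
  \<open>\<beta> = \<phi>'' - \<phi>' / r\<close>.\<close>

definition rank_one_pert :: "real \<Rightarrow> real \<Rightarrow> real ^ 'n \<Rightarrow> real ^ 'n ^ 'n::finite" where
  "rank_one_pert \<alpha> \<beta> e = (\<chi> i j. (if i = j then \<alpha> else 0) + \<beta> * e $ i * e $ j)"

lemma det_rank_one_pert: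
  fixes e :: "real ^ 'n::finite"
  assumes "norm e = 1"
  shows "det (rank_one_pert \<alpha> \<beta> e) = \<alpha> ^ (CARD('n) - 1) * (\<alpha> + \<beta>)"
proof -
  fix i0 :: 'n
  \<comment> \<open>Conjugation by an orthogonal matrix that sends a basis vector to
    \<open>e\<close> makes the matrix diagonal, with the one exceptional entry
    \<open>\<alpha> + \<beta>\<close> at \<open>i0\<close>.\<close>
  obtain R where R: "orthogonal_matrix R" "R *v axis i0 1 = e"
    using orthogonal_matrix_exists_basis [OF assms] by blast
  have RRt: "R ** transpose R = mat 1"
    using R(1) by (simp add: orthogonal_matrix_def)
  have col: "R $ i $ i0 = e $ i" for i
    unfolding R(2)[symmetric] by (simp add: matrix_vector_mult_basis column_def)
  define D :: "real ^ 'n ^ 'n" where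
    "D = (\<chi> i j. if i = j then (if i = i0 then \<alpha> + \<beta> else \<alpha>) else 0)"
  have RD: "(R ** D) $ i $ k = R $ i $ k * (if k = i0 then \<alpha> + \<beta> else \<alpha>)" for i k
    by (simp add: matrix_matrix_mult_def D_def if_distrib [of "\<lambda>x. _ * x"] sum.delta
        cong: if_cong)
  have one: "(\<Sum>k\<in>UNIV. R $ i $ k * R $ j $ k) = (if i = j then 1 else 0)" for i j
    using arg_cong [OF RRt, of "\<lambda>M. M $ i $ j"]
    by (simp add: matrix_matrix_mult_def transpose_def mat_def)
  have "(R ** D ** transpose R) $ i $ j = rank_one_pert \<alpha> \<beta> e $ i $ j" for i j
  proof -
    have "(R ** D ** transpose R) $ i $ j =
        (\<Sum>k\<in>UNIV. R $ i $ k * (if k = i0 then \<alpha> + \<beta> else \<alpha>) * R $ j $ k)"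
      by (subst matrix_matrix_mult_def) (simp add: RD transpose_def)
    also have "\<dots> = (\<Sum>k\<in>UNIV. \<alpha> * (R $ i $ k * R $ j $ k) +
        (if k = i0 then \<beta> * R $ i $ k * R $ j $ k else 0))"
      by (intro sum.cong) (auto simp: algebra_simps)
    also have "\<dots> = (if i = j then \<alpha> else 0) + \<beta> * e $ i * e $ j"
      by (simp add: sum.distrib sum_distrib_left [symmetric] one col)
    finally show ?thesis by (simp add: rank_one_pert_def)
  qed
  then have "rank_one_pert \<alpha> \<beta> e = R ** D ** transpose R"
    by (simp add: vec_eq_iff)
  moreover have "det R * det (transpose R) = 1"
    using RRt by (metis det_mul det_I)
  ultimately have "det (rank_one_pert \<alpha> \<beta> e) = det D"
    by (simp add: det_mul mult.commute)
  also have "\<dots> = (\<Prod>i\<in>UNIV. if i = i0 then \<alpha> + \<beta> else \<alpha>)"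
    by (subst det_diagonal) (auto simp: D_def)
  also have "\<dots> = (\<alpha> + \<beta>) * (\<Prod>i\<in>UNIV - {i0}. \<alpha>)"
    by (subst prod.remove [of _ i0]) (auto intro!: prod.cong)
  finally show ?thesis
    by (simp add: card_Diff_singleton)
qed

text \<open>\<open>eigenvalue_vector\<close> is an arbitrary choice, known only through its
  characteristic polynomial. Its elementary symmetric functions are therefore recovered by comparing
  coefficients of the product of the factors \<open>1 + s * l $ i\<close>.\<close>

lemma elem_sym_eigenvalue_vector_rank_one_pert:
  fixes e :: "real ^ 'n::finite"
  assumes e: "norm e = 1" and j: "1 \<le> j" "j \<le> CARD('n)"
  shows "elem_sym j (eigenvalue_vector (rank_one_pert \<alpha> \<beta> e)) =
     real ((CARD('n) - 1) choose j) * \<alpha> ^ j +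
     real ((CARD('n) - 1) choose (j - 1)) * \<alpha> ^ (j - 1) * (\<alpha> + \<beta>)"
proof -
  define N where "N = CARD('n)"
  have N: "N > 0" by (simp add: N_def)
  have charpoly: "det (mat t - rank_one_pert \<alpha> \<beta> e) = (t - \<alpha>) ^ (N - 1) * (t - (\<alpha> + \<beta>))" for t
  proof -
    have "mat t - rank_one_pert \<alpha> \<beta> e = rank_one_pert (t - \<alpha>) (- \<beta>) e"
      by (simp add: vec_eq_iff rank_one_pert_def mat_def)
    then show ?thesis
      by (simp add: det_rank_one_pert [OF e] N_def algebra_simps)
  qed
  fix i0 :: 'n
  define d :: "real ^ 'n" where "d = (\<chi> i. if i = i0 then \<alpha> + \<beta> else \<alpha>)"
  have prod_d: "(\<Prod>i\<in>UNIV. x - s * d $ i) = (x - s * \<alpha>) ^ (N - 1) * (x - s * (\<alpha> + \<beta>))" for x s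
  proof -
    have "(\<Prod>i\<in>UNIV. x - s * d $ i) = (x - s * d $ i0) * (\<Prod>i\<in>UNIV - {i0}. x - s * \<alpha>)"
      by (subst prod.remove [of _ i0]) (auto intro!: prod.cong simp: d_def)
    then show ?thesis
      by (simp add: d_def N_def card_Diff_singleton)
  qed
  define l where "l = eigenvalue_vector (rank_one_pert \<alpha> \<beta> e)"
  \<comment> \<open>\<open>d\<close> only shows that a vector of eigenvalues exists; the chosen
    \<open>l\<close> may be any rearrangement of it.\<close>
  have "\<exists>l :: real ^ 'n. \<forall>t. det (mat t - rank_one_pert \<alpha> \<beta> e) = (\<Prod>i\<in>UNIV. t - l $ i)"
    by (rule exI [of _ d]) (use prod_d [where s = 1] charpoly in simp)
  then have "\<forall>t. det (mat t - rank_one_pert \<alpha> \<beta> e) = (\<Prod>i\<in>UNIV. t - l $ i)"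
    unfolding l_def eigenvalue_vector_def by (rule someI_ex)
  then have l: "(\<Prod>i\<in>UNIV. t - l $ i) = (t - \<alpha>) ^ (N - 1) * (t - (\<alpha> + \<beta>))" for t
    by (simp add: charpoly)
  have gen: "(\<Prod>i\<in>UNIV. 1 + s * l $ i) = (1 + s * \<alpha>) ^ (N - 1) * (1 + s * (\<alpha> + \<beta>))" for s
  proof (cases "s = 0")
    case False
    \<comment> \<open>The substitution reverses the polynomial: each factor \<open>1 + s x\<close>
      becomes \<open>- s (t - x)\<close>.\<close>
    define t where "t = - (1 / s)"
    have st: "1 + s * x = (- s) * (t - x)" for x
      using False by (simp add: t_def field_simps)
    have "(\<Prod>i\<in>UNIV. 1 + s * l $ i) = (- s) ^ N * (\<Prod>i\<in>UNIV. t - l $ i)"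
      unfolding st prod.distrib by (simp add: N_def)
    also have "\<dots> = ((- s) * (t - \<alpha>)) ^ (N - 1) * ((- s) * (t - (\<alpha> + \<beta>)))"
      unfolding l power_mult_distrib using N by (cases N) simp_all
    finally show ?thesis unfolding st .
  qed simp
  \<comment> \<open>The coefficient of \<open>s ^ j\<close> on the right of \<open>gen\<close>. The
    case \<open>j = 0\<close> is separate because \<open>j - 1\<close> truncates to 0.\<close>
  define c where "c j = real ((N - 1) choose j) * \<alpha> ^ j +
     (if j = 0 then 0 else real ((N - 1) choose (j - 1)) * \<alpha> ^ (j - 1) * (\<alpha> + \<beta>))" for j
  have "(1 + s * \<alpha>) ^ (N - 1) * (1 + s * (\<alpha> + \<beta>)) = (\<Sum>j\<le>N. c j * s ^ j)" for s
  proof -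
    obtain M where M: "N = Suc M" using N by (cases N) auto
    have b: "(1 + s * \<alpha>) ^ M = (\<Sum>j\<le>M. real (M choose j) * \<alpha> ^ j * s ^ j)"
      using binomial_ring [of "s * \<alpha>" 1 M]
      by (simp add: add.commute power_mult_distrib ac_simps)
    have "(\<Sum>j\<le>N. c j * s ^ j) =
      (\<Sum>j\<le>N. real (M choose j) * \<alpha> ^ j * s ^ j) +
      (\<Sum>j\<le>N. if j = 0 then 0 else real (M choose (j - 1)) * \<alpha> ^ (j - 1) * (\<alpha> + \<beta>) * s ^ j)"
      unfolding sum.distrib [symmetric]
      by (intro sum.cong) (auto simp: c_def M algebra_simps)
    also have "(\<Sum>j\<le>N. real (M choose j) * \<alpha> ^ j * s ^ j) = (1 + s * \<alpha>) ^ M"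
      by (simp add: M b)
    also have "(\<Sum>j\<le>N. if j = 0 then 0 else real (M choose (j - 1)) * \<alpha> ^ (j - 1) * (\<alpha> + \<beta>) * s ^ j)
       = (\<Sum>j\<le>M. real (M choose j) * \<alpha> ^ j * s ^ j * (s * (\<alpha> + \<beta>)))"
      unfolding M sum.atMost_Suc_shift by (simp add: ac_simps)
    also have "\<dots> = (1 + s * \<alpha>) ^ M * (s * (\<alpha> + \<beta>))"
      unfolding b sum_distrib_right ..
    finally show ?thesis by (simp add: M algebra_simps)
  qed
  then have "(\<Sum>j\<le>N. elem_sym j l * s ^ j) = (\<Sum>j\<le>N. c j * s ^ j)" for s
    using gen [of s] prod_one_plus_eq_elem_sym [of s l] by (simp add: N_def)
  then have "elem_sym j l = c j"
    using polyfun_eq_coeffs [of "\<lambda>j. elem_sym j l" N c] j by (simp add: N_def)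
  then show ?thesis
    using j by (simp add: l_def c_def N_def)
qed

section \<open>Hessians of radial functions\<close>

lemma partial_deriv_eq:
  assumes "(u has_derivative u') (at x)"
  shows "partial_deriv i u x = u' (axis i 1)"
  using frechet_derivative_at [OF assms] by (simp add: partial_deriv_def)

lemma has_derivative_radial:
  fixes x :: "'a::real_inner"
  assumes "x \<noteq> 0" and "(\<phi> has_real_derivative d) (at (norm x))"
  shows "((\<lambda>y. \<phi> (norm y)) has_derivative (\<lambda>v. d * (sgn x \<bullet> v))) (at x)"
proof -
  have "(norm has_derivative (\<lambda>v. v \<bullet> sgn x)) (at x)"
    using assms(1) by (rule has_derivative_norm)
  from has_derivative_compose [OF this assms(2)[unfolded has_field_derivative_def]]
  show ?thesis by (simp add: inner_commute)
qed

lemma has_derivative_radial_times_component: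
  fixes x :: "real ^ 'n::finite"
  assumes "x \<noteq> 0" and "(a has_real_derivative d) (at (norm x))"
  shows "((\<lambda>y. a (norm y) * y $ j) has_derivative
           (\<lambda>v. a (norm x) * v $ j + d * (sgn x \<bullet> v) * x $ j)) (at x)"
  by (rule has_derivative_mult [OF has_derivative_radial [OF assms]
        bounded_linear_imp_has_derivative [OF bounded_linear_vec_nth]])

lemma sgn_component: "sgn x $ i = x $ i / norm x"
  for x :: "real ^ 'n::finite"
  by (simp add: sgn_div_norm divide_inverse mult.commute)

text \<open>The entries come from the product rule for \<open>a (norm y) * y $ j\<close>. Writing
  the derivative of \<open>a\<close> as \<open>b / norm x\<close> makes \<open>b = r a'\<close> the
  rank-one coefficient; it is \<open>b\<close>, not \<open>a'\<close>, that is controlled at the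
  origin later.\<close>

lemma hessian_radial:
  fixes x :: "real ^ 'n::finite"
  assumes "x \<noteq> 0" and grad: "\<And>y j. y \<noteq> 0 \<Longrightarrow> partial_deriv j u y = a (norm y) * y $ j"
    and a: "(a has_real_derivative b / norm x) (at (norm x))"
  shows "hessian u x = rank_one_pert (a (norm x)) b (sgn x)"
proof -
  have "(partial_deriv j u has_derivative
      (\<lambda>v. a (norm x) * v $ j + b / norm x * (sgn x \<bullet> v) * x $ j)) (at x)" for j
    by (rule has_derivative_transform_within_open
          [OF has_derivative_radial_times_component [OF assms(1) a], where s = "- {0}"])
      (use assms(1) grad in auto)
  from partial_deriv_eq [OF this]
  have "partial_deriv i (partial_deriv j u) x =
      a (norm x) * axis i 1 $ j + b * sgn x $ i * sgn x $ j" for i j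
    by (simp add: inner_axis) (simp add: sgn_component)
  then show ?thesis
    by (simp add: vec_eq_iff hessian_def rank_one_pert_def axis_def)
qed

lemma has_derivative_0_iff:
  fixes f :: "'a::real_normed_vector \<Rightarrow> 'b::real_normed_vector"
  assumes "bounded_linear f'"
  shows "(f has_derivative f') (at 0) \<longleftrightarrow>
     ((\<lambda>y. norm (f y - f 0 - f' y) / norm y) \<longlongrightarrow> 0) (at 0)"
  using assms unfolding has_derivative_iff_norm by simp

text \<open>Transfers one-sided limits of a profile at \<open>r = 0\<close> to limits at the origin
  of the space.\<close>

lemma filterlim_norm_at_0: "filterlim norm (at 0 within {0..}) (at (0::'a::real_normed_vector))"
  by (auto simp: filterlim_at eventually_at_filter intro!: tendsto_eq_intros)

text \<open>Away from the origin this is the chain rule. At the origin \<open>norm\<close> is not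
  differentiable and \<open>sgn\<close> is discontinuous, so both derivatives are computed there
  from difference quotients, and \<open>b 0 = 0\<close> absorbs the bounded factors
  \<open>sgn x $ i\<close>.\<close>

lemma radial_C2_hessian:
  fixes \<phi> a b :: "real \<Rightarrow> real"
  assumes \<phi>: "\<And>r. r \<ge> 0 \<Longrightarrow> (\<phi> has_real_derivative r * a r) (at r within {0..})"
    and a: "\<And>r. r > 0 \<Longrightarrow> (a has_real_derivative b r / r) (at r)"
    and conta: "continuous_on {0..} a" and contb: "continuous_on {0..} b" and b0: "b 0 = 0"
  shows "(\<lambda>x :: real ^ 'n::finite. \<phi> (norm x)) \<in> C2" (is "?u \<in> C2")
    and "hessian (\<lambda>x :: real ^ 'n::finite. \<phi> (norm x)) x
           = rank_one_pert (a (norm x)) (b (norm x)) (sgn x)"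
proof -
  have \<phi>': "(\<phi> has_real_derivative r * a r) (at r)" if "r > 0" for r
    using \<phi> [of r] that at_within_interior [of r "{0..}"] by simp
  have ta: "((\<lambda>x::real^'n. a (norm x)) \<longlongrightarrow> a 0) (at 0)"
    using filterlim_compose [OF conta[unfolded continuous_on_def, rule_format, of 0] filterlim_norm_at_0]
    by simp
  have D0: "(?u has_derivative (\<lambda>v. 0)) (at 0)"
  proof -
    have "((\<lambda>r. (\<phi> r - \<phi> 0) / r) \<longlongrightarrow> 0) (at 0 within {0..})"
      using \<phi> [of 0] by (simp add: has_field_derivative_iff)
    from tendsto_norm_zero [OF filterlim_compose [OF this filterlim_norm_at_0]]
    show ?thesis by (subst has_derivative_0_iff) auto
  qed
  have grad: "(?u has_derivative (\<lambda>v. a (norm x) * (x \<bullet> v))) (at x)" for x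
  proof (cases "x = 0")
    case False
    then have "(\<lambda>v. norm x * a (norm x) * (sgn x \<bullet> v)) = (\<lambda>v. a (norm x) * (x \<bullet> v))"
      by (auto simp: sgn_div_norm)
    then show ?thesis
      using has_derivative_radial [OF False \<phi>'] False by simp
  qed (use D0 in simp)
  have pd: "partial_deriv j ?u x = a (norm x) * x $ j" for x j
    using partial_deriv_eq [OF grad] by (simp add: inner_axis)
  have pd': "partial_deriv j ?u = (\<lambda>x. a (norm x) * x $ j)" for j
    by (rule ext) (rule pd)
  have D20: "((\<lambda>x. a (norm x) * x $ j) has_derivative (\<lambda>v. a 0 * v $ j)) (at (0 :: real^'n))" for j
  proof (subst has_derivative_0_iff)
    show "bounded_linear (\<lambda>v::real^'n. a 0 * v $ j)"
      by (intro bounded_linear_const_mult bounded_linear_vec_nth)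
    have "((\<lambda>x::real^'n. \<bar>a (norm x) - a 0\<bar>) \<longlongrightarrow> 0) (at 0)"
      using tendsto_rabs_zero [OF LIM_zero [OF ta]] .
    then show "((\<lambda>y::real^'n. norm (a (norm y) * y $ j - a (norm (0::real^'n)) * (0::real^'n) $ j - a 0 * y $ j) / norm y) \<longlongrightarrow> 0) (at 0)"
    proof (rule tendsto_sandwich [OF _ _ tendsto_const, rotated 2])
      show "\<forall>\<^sub>F y::real^'n in at 0. norm (a (norm y) * y $ j - a (norm (0::real^'n)) * (0::real^'n) $ j - a 0 * y $ j) / norm y \<le> \<bar>a (norm y) - a 0\<bar>"
      proof (rule always_eventually, rule allI)
        fix y :: "real^'n"
        have "\<bar>(a (norm y) - a 0) * y $ j\<bar> \<le> \<bar>a (norm y) - a 0\<bar> * norm y"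
          unfolding abs_mult by (intro mult_left_mono component_le_norm_cart) auto
        then show "norm (a (norm y) * y $ j - a (norm (0::real^'n)) * (0::real^'n) $ j - a 0 * y $ j) / norm y \<le> \<bar>a (norm y) - a 0\<bar>"
          by (cases "y = 0") (simp_all add: field_simps)
      qed
    qed simp
  qed
  have D2: "\<exists>D. ((\<lambda>x. a (norm x) * x $ j) has_derivative D) (at x)" for x :: "real^'n" and j
    using D20 [of j] has_derivative_radial_times_component [of x a, OF _ a, where j = j]
    by (cases "x = 0") auto
  have hess: "hessian ?u x = rank_one_pert (a (norm x)) (b (norm x)) (sgn x)" for x
  proof (cases "x = 0")
    case True
    then show ?thesis
      by (simp add: hessian_def vec_eq_iff [of "vec_lambda _"] rank_one_pert_def pd' b0
          partial_deriv_eq [OF D20]) (simp add: axis_def)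
  qed (use pd a in \<open>auto intro!: hessian_radial\<close>)
  then show "hessian ?u x = rank_one_pert (a (norm x)) (b (norm x)) (sgn x)" .
  have contan: "continuous_on UNIV (\<lambda>x::real^'n. a (norm x))"
    and contbn: "continuous_on UNIV (\<lambda>x::real^'n. b (norm x))"
    by (auto intro!: continuous_on_compose2 [OF conta] continuous_on_compose2 [OF contb] continuous_intros)
  have "continuous_on UNIV (\<lambda>x. partial_deriv i (partial_deriv j ?u) x)" for i j
  proof -
    have eq: "partial_deriv i (partial_deriv j ?u) x =
       (if i = j then a (norm x) else 0) + b (norm x) * sgn x $ i * sgn x $ j" for x
      using arg_cong [OF hess [of x], of "\<lambda>M. M $ i $ j"]
      by (simp add: hessian_def rank_one_pert_def)
    have "isCont (\<lambda>x::real^'n. b (norm x) * sgn x $ i * sgn x $ j) x" for x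
    proof (cases "x = 0")
      case False
      have "isCont (\<lambda>x::real^'n. b (norm x)) x"
        using contbn by (simp add: continuous_on_eq_continuous_at)
      moreover have "isCont (\<lambda>x::real^'n. sgn x $ i) x" for i
        using False by (simp add: sgn_component)
      ultimately show ?thesis by (intro continuous_mult)
    next
      case True
      have "isCont (\<lambda>x::real^'n. b (norm x)) 0"
        using contbn by (simp add: continuous_on_eq_continuous_at)
      then have lim: "((\<lambda>x::real^'n. \<bar>b (norm x)\<bar>) \<longlongrightarrow> 0) (at 0)"
        using b0 by (auto simp: isCont_def intro: tendsto_rabs_zero)
      have le: "\<bar>b (norm y) * sgn y $ i * sgn y $ j\<bar> \<le> \<bar>b (norm y)\<bar>" for y :: "real^'n"
      proof -
        have s: "\<bar>sgn y $ i\<bar> \<le> 1" for i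
          using component_le_norm_cart [of "sgn y" i] by (simp add: norm_sgn split: if_splits)
        show ?thesis
          using mult_mono [OF s [of i] s [of j]] mult_left_le [of "\<bar>sgn y $ i\<bar> * \<bar>sgn y $ j\<bar>" "\<bar>b (norm y)\<bar>"]
          by (simp add: abs_mult mult.assoc)
      qed
      have "((\<lambda>x::real^'n. b (norm x) * sgn x $ i * sgn x $ j) \<longlongrightarrow> 0) (at 0)"
        using lim by (rule Lim_null_comparison [rotated]) (simp add: le)
      then show ?thesis using True by (simp add: isCont_def)
    qed
    then have "continuous_on UNIV (\<lambda>x::real^'n. b (norm x) * sgn x $ i * sgn x $ j)"
      by (simp add: continuous_on_eq_continuous_at)
    with contan show ?thesis
      unfolding eq by (cases "i = j") (auto intro: continuous_on_add)
  qed
  then show "?u \<in> C2"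
    using grad D2 by (auto simp: C2_def differentiable_def pd')
qed

text \<open>The profile is the restriction of \<open>u\<close> to a whole coordinate line, so it is
  also defined and differentiable for negative \<open>r\<close>.\<close>

lemma radial_C2_E:
  fixes u :: "real ^ 'n::finite \<Rightarrow> real"
  assumes u: "u \<in> C2" "radial u"
  obtains \<phi> d d2 where "\<And>x. u x = \<phi> (norm x)"
    and "\<And>r. (\<phi> has_real_derivative d r) (at r)"
    and "d 0 = 0" and "\<And>r. (d has_real_derivative d2 r) (at r)"
    and "\<And>x. x \<noteq> 0 \<Longrightarrow> hessian u x = 
         rank_one_pert (d (norm x) / norm x) (d2 (norm x) - d (norm x) / norm x) (sgn x)"
proof -
  fix i0 :: 'n
  let ?e = "axis i0 1 :: real ^ 'n"
  have line: "((\<lambda>r. v (r *\<^sub>R ?e)) has_real_derivative partial_deriv i0 v (r *\<^sub>R ?e)) (at r)"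
    if "v differentiable (at (r *\<^sub>R ?e))" for v r
  proof -
    have 1: "((\<lambda>r. r *\<^sub>R ?e) has_derivative (\<lambda>s. s *\<^sub>R ?e)) (at r)"
      by (auto intro!: derivative_eq_intros)
    have 2: "(v has_derivative frechet_derivative v (at (r *\<^sub>R ?e))) (at (r *\<^sub>R ?e))"
      using that by (simp add: frechet_derivative_works)
    from has_derivative_compose [OF 1 2] linear_scale [OF has_derivative_linear [OF 2]]
    show ?thesis
      by (simp add: has_field_derivative_def partial_deriv_def mult_commute_abs)
  qed
  define \<phi> where "\<phi> r = u (r *\<^sub>R ?e)" for r
  define d where "d r = partial_deriv i0 u (r *\<^sub>R ?e)" for r
  define d2 where "d2 r = partial_deriv i0 (partial_deriv i0 u) (r *\<^sub>R ?e)" for r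
  have u\<phi>: "u x = \<phi> (norm x)" for x
    using u(2)[unfolded radial_def, rule_format, of x "norm x *\<^sub>R ?e"] by (simp add: \<phi>_def)
  have d: "(\<phi> has_real_derivative d r) (at r)" for r
    unfolding \<phi>_def d_def using u(1) by (intro line) (simp add: C2_def)
  have d2: "(d has_real_derivative d2 r) (at r)" for r
    unfolding d2_def d_def using u(1) by (intro line) (simp add: C2_def)
  \<comment> \<open>A radial function is even along the line, so its derivative at 0 equals its own
    negative.\<close>
  have "(\<lambda>r. \<phi> (- r)) = \<phi>"
    using u(2) by (auto simp: radial_def \<phi>_def)
  then have "(\<phi> has_real_derivative - d 0) (at 0)"
    using DERIV_mirror [of \<phi> "d 0" 0] d [of 0] by simp
  from DERIV_unique [OF this d] have d0: "d 0 = 0" by simp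
  have "hessian u x = rank_one_pert (d (norm x) / norm x) (d2 (norm x) - d (norm x) / norm x) (sgn x)"
    if "x \<noteq> 0" for x
  proof (rule hessian_radial [where a = "\<lambda>r. d r / r", OF that])
    fix y j assume "y \<noteq> (0 :: real^'n)"
    have "u = (\<lambda>x. \<phi> (norm x))" using u\<phi> by auto
    then show "partial_deriv j u y = d (norm y) / norm y * y $ j"
      using partial_deriv_eq [OF has_derivative_radial [OF \<open>y \<noteq> 0\<close> d]]
      by (simp add: inner_axis sgn_component)
  next
    show "((\<lambda>r. d r / r) has_real_derivative (d2 (norm x) - d (norm x) / norm x) / norm x) (at (norm x))"
      using that by (auto intro!: derivative_eq_intros d2 simp: field_simps)
  qed
  from that [OF u\<phi> d d0 d2 this] show thesis .
qed

section \<open>The radial equation in integral form\<close>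

lemma binom_pred_pos: "1 \<le> k \<Longrightarrow> k \<le> N \<Longrightarrow> real ((N - 1) choose (k - 1)) > 0"
  by (simp add: binomial_eq_0_iff)

lemma binomial_pred_ratio:
  assumes "1 \<le> j" "j \<le> N"
  shows "real j * real ((N - 1) choose j) = (real N - real j) * real ((N - 1) choose (j - 1))"
proof -
  obtain i where i: "j = Suc i" using assms by (cases j) auto
  have "Suc i * ((N - 1) choose Suc i) = (N - 1 - i) * ((N - 1) choose i)"
    by (simp only: binomial_absorption binomial_absorb_comp)
  from arg_cong [OF this, of real] show ?thesis
    using assms unfolding of_nat_mult by (simp add: i of_nat_diff)
qed

text \<open>\<open>S\<^sub>j\<close> of the vector in \<open>\<real>\<^sup>N\<close> with entries \<open>\<alpha>\<close> (\<open>N - 1\<close> times) and \<open>\<mu>\<close>.\<close>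

definition radial_symm :: "nat \<Rightarrow> nat \<Rightarrow> real \<Rightarrow> real \<Rightarrow> real" where
  "radial_symm N j \<alpha> \<mu> =
     real ((N - 1) choose j) * \<alpha> ^ j + real ((N - 1) choose (j - 1)) * \<alpha> ^ (j - 1) * \<mu>"

text \<open>The absorption identity for binomial coefficients extracts a common factor. For
  \<open>\<alpha> > 0\<close> only the sign of an expression affine in \<open>\<mu>\<close> is left
  to discuss.\<close>

lemma radial_symm_eq:
  assumes "1 \<le> j" "j \<le> N"
  shows "radial_symm N j \<alpha> \<mu> =
     real ((N - 1) choose (j - 1)) / real j * \<alpha> ^ (j - 1) * ((real N - real j) * \<alpha> + real j * \<mu>)"
proof -
  have "\<alpha> ^ j = \<alpha> ^ (j - 1) * \<alpha>"
    using assms by (cases j) auto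
  moreover have "real ((N - 1) choose j) = (real N - real j) / real j * real ((N - 1) choose (j - 1))"
    using binomial_pred_ratio [OF assms] assms by (simp add: field_simps)
  ultimately show ?thesis
    using assms by (simp add: radial_symm_def ring_distribs add_divide_distrib diff_divide_distrib)
qed

lemma pos_zero_less_mult_iff: "x > 0 \<Longrightarrow> 0 < x * y \<longleftrightarrow> 0 < y" for x y :: real
  by (simp add: zero_less_mult_iff)

text \<open>For \<open>\<alpha> > 0\<close> the sign of \<open>S_j\<close> is that of
  \<open>N \<alpha> + j (\<mu> - \<alpha>)\<close>. This is affine in \<open>j\<close> and positive
  at \<open>j = 0\<close> and at \<open>j = k\<close>, hence in between.\<close>

lemma radial_symm_pos_mono:
  assumes "1 \<le> j" "j \<le> k" "k \<le> N" "\<alpha> > 0" "radial_symm N k \<alpha> \<mu> > 0"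
  shows "radial_symm N j \<alpha> \<mu> > 0"
proof -
  have *: "radial_symm N i \<alpha> \<mu> > 0 \<longleftrightarrow> (real N - real i) * \<alpha> + real i * \<mu> > 0"
    if "1 \<le> i" "i \<le> N" for i
  proof -
    have "real ((N - 1) choose (i - 1)) / real i * \<alpha> ^ (i - 1) > 0"
      using that \<open>\<alpha> > 0\<close> binom_pred_pos [OF that] by simp
    then show ?thesis
      unfolding radial_symm_eq [OF that] by (rule pos_zero_less_mult_iff)
  qed
  have pos: "real N * \<alpha> + real k * (\<mu> - \<alpha>) > 0"
    using * [of k] assms by (simp add: algebra_simps)
  have "real N * \<alpha> + real j * (\<mu> - \<alpha>) > 0"
  proof (cases "\<mu> \<ge> \<alpha>")
    case True
    then show ?thesis using assms by (intro add_pos_nonneg) auto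
  next
    case False
    then have "real k * (\<mu> - \<alpha>) \<le> real j * (\<mu> - \<alpha>)"
      using assms by (intro mult_right_mono_neg) auto
    then show ?thesis using pos by simp
  qed
  then show ?thesis using * [of j] assms by (simp add: algebra_simps)
qed

text \<open>For \<open>r > 0\<close> this is \<open>r\<^bsup>-N\<^esup>\<close> times the integral of \<open>s\<^bsup>N-1\<^esup> h s\<close> over \<open>[0, r]\<close>. The scaled form needs no
  special case at \<open>r = 0\<close>, where it has the limit \<open>h 0 / N\<close> as its value.\<close>

definition avg :: "nat \<Rightarrow> (real \<Rightarrow> real) \<Rightarrow> real \<Rightarrow> real" where
  "avg N h r = integral {0..1} (\<lambda>\<tau>. \<tau> ^ (N - 1) * h (r * \<tau>))"

text \<open>\<open>rsol\<close> is the radial profile \<open>\<phi>\<close> with \<open>\<phi> 0 = 0\<close> whose \<open>S\<^sub>k\<close> is \<open>h\<close>, \<open>slope\<close> is \<open>\<phi>' / r\<close>, and \<open>curv\<close> below is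
  \<open>\<phi>'' - \<phi>' / r\<close>.\<close>

definition slope :: "nat \<Rightarrow> nat \<Rightarrow> (real \<Rightarrow> real) \<Rightarrow> real \<Rightarrow> real" where
  "slope N k h r = root k (real k / real ((N - 1) choose (k - 1)) * avg N h r)"

definition rsol :: "nat \<Rightarrow> nat \<Rightarrow> (real \<Rightarrow> real) \<Rightarrow> real \<Rightarrow> real" where
  "rsol N k h r = integral {0..r} (\<lambda>s. s * slope N k h s)"

section \<open>Regularity, monotonicity and positivity of weighted averages and slopes\<close>

lemma continuous_on_avg_integrand:
  fixes h :: "real \<Rightarrow> real"
  assumes "continuous_on {0..} h" "r \<ge> 0"
  shows "continuous_on {0..1} (\<lambda>\<tau>. \<tau> ^ (N - 1) * h (r * \<tau>))"
  by (intro continuous_intros continuous_on_compose2 [OF assms(1)]) (use assms(2) in auto)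

lemma avg_integrand_integrable:
  fixes h :: "real \<Rightarrow> real"
  assumes "continuous_on {0..} h" "r \<ge> 0"
  shows "(\<lambda>\<tau>. \<tau> ^ (N - 1) * h (r * \<tau>)) integrable_on {0..1}"
  by (rule integrable_continuous_real) (rule continuous_on_avg_integrand [OF assms])

lemma avg_mono:
  assumes "continuous_on {0..} h" "continuous_on {0..} h'" "\<And>s. s \<ge> 0 \<Longrightarrow> h s \<le> h' s" "r \<ge> 0"
  shows "avg N h r \<le> avg N h' r"
  unfolding avg_def using assms
  by (intro integral_le avg_integrand_integrable mult_left_mono) auto

lemma continuous_on_avg:
  assumes "continuous_on {0..} h"
  shows "continuous_on {0..} (avg N h)"
proof -
  have "continuous_on ({0..} \<times> cbox 0 1) (\<lambda>(r, \<tau>). \<tau> ^ (N - 1) * h (r * \<tau>))"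
    unfolding case_prod_unfold
    by (intro continuous_intros continuous_on_compose2 [OF assms]) auto
  from integral_continuous_on_param [OF this] show ?thesis
    unfolding avg_def [abs_def] by simp
qed

lemma avg_const:
  assumes "N \<ge> 1"
  shows "avg N (\<lambda>_. c) r = c / real N"
proof -
  have "((\<lambda>\<tau>. \<tau> ^ (N - 1) * c) has_integral (1 ^ N * c / real N - 0 ^ N * c / real N)) {0..1}"
    using assms
    by (intro fundamental_theorem_of_calculus)
       (auto intro!: derivative_eq_intros simp flip: has_real_derivative_iff_has_vector_derivative)
  with assms have "((\<lambda>\<tau>. \<tau> ^ (N - 1) * c) has_integral c / real N) {0..1}"
    by (simp add: power_0_left)
  then show ?thesis
    unfolding avg_def by (rule integral_unique)
qed

lemma avg_0:
  assumes "N \<ge> 1"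
  shows "avg N h 0 = h 0 / real N"
  using avg_const [OF assms, of "h 0" 0] by (simp add: avg_def)

lemma avg_nonneg:
  assumes "continuous_on {0..} h" "\<And>s. s \<ge> 0 \<Longrightarrow> h s \<ge> 0" "r \<ge> 0"
  shows "avg N h r \<ge> 0"
  unfolding avg_def using assms
  by (intro integral_nonneg avg_integrand_integrable mult_nonneg_nonneg) auto

text \<open>On \<open>[0, r]\<close> the source is bounded below by its minimum, which is attained
  and so positive; the average of a constant is explicit.\<close>

lemma avg_pos:
  assumes "N \<ge> 1" and h: "continuous_on {0..} h" "\<And>s. s \<ge> 0 \<Longrightarrow> h s > 0" and "r \<ge> 0"
  shows "avg N h r > 0"
proof -
  have "continuous_on {0..r} h"
    using h(1) by (rule continuous_on_subset) auto
  then obtain s0 where s0: "s0 \<in> {0..r}" "\<And>s. s \<in> {0..r} \<Longrightarrow> h s0 \<le> h s"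
    using continuous_attains_inf [of "{0..r}" h] \<open>r \<ge> 0\<close> by auto
  have "0 < h s0 / real N"
    using s0(1) h(2) assms(1) by simp
  also have "\<dots> = avg N (\<lambda>_. h s0) r"
    using avg_const [OF assms(1)] by simp
  also have "\<dots> \<le> avg N h r"
    unfolding avg_def
  proof (intro integral_le avg_integrand_integrable mult_left_mono)
    fix \<tau> :: real assume "\<tau> \<in> {0..1}"
    then show "h s0 \<le> h (r * \<tau>)"
      using \<open>r \<ge> 0\<close> by (intro s0(2)) (auto simp: mult_left_le)
  qed (use assms in auto)
  finally show ?thesis .
qed

lemma avg_eq:
  assumes "N \<ge> 1" and h: "continuous_on {0..} h" and "r > 0"
  shows "avg N h r = integral {0..r} (\<lambda>s. s ^ (N - 1) * h s) / r ^ N"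
proof -
  have "continuous_on {0..r} (\<lambda>s. s ^ (N - 1) * h s)"
    by (intro continuous_intros continuous_on_subset [OF h]) auto
  then have "((\<lambda>s. s ^ (N - 1) * h s) has_integral integral {0..r} (\<lambda>s. s ^ (N - 1) * h s)) {0..r}"
    by (intro integrable_integral integrable_continuous_real)
  from has_integral_stretch_real [OF this, of r]
  have "((\<lambda>\<tau>. (r * \<tau>) ^ (N - 1) * h (r * \<tau>)) has_integral
      integral {0..r} (\<lambda>s. s ^ (N - 1) * h s) / r) ((\<lambda>x. x / r) ` {0..r})"
    using \<open>r > 0\<close> by simp
  also have "(\<lambda>x. x / r) ` {0..r} = {0..1}"
    using \<open>r > 0\<close> by simp
  finally have "((\<lambda>\<tau>. 1 / r ^ (N - 1) * ((r * \<tau>) ^ (N - 1) * h (r * \<tau>))) has_integral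
      1 / r ^ (N - 1) * (integral {0..r} (\<lambda>s. s ^ (N - 1) * h s) / r)) {0..1}"
    by (rule has_integral_mult_right)
  moreover have "(\<lambda>\<tau>. 1 / r ^ (N - 1) * ((r * \<tau>) ^ (N - 1) * h (r * \<tau>))) =
      (\<lambda>\<tau>. \<tau> ^ (N - 1) * h (r * \<tau>))"
    using \<open>r > 0\<close> by (auto simp: power_mult_distrib)
  moreover have "r ^ N = r ^ (N - 1) * r"
    using assms by (cases N) auto
  ultimately show ?thesis
    by (simp add: avg_def integral_unique)
qed

lemma integral_has_real_derivative_at:
  assumes "continuous_on {a..} g" "x > a"
  shows "((\<lambda>x. integral {a..x} g) has_real_derivative g x) (at x)"
proof -
  have "continuous_on {a..x + 1} g"
    using assms(1) by (rule continuous_on_subset) auto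
  then have "((\<lambda>x. integral {a..x} g) has_real_derivative g x) (at x within {a..x + 1})"
    using assms(2) by (intro integral_has_real_derivative) auto
  then show ?thesis
    using assms(2) at_within_interior [of x "{a..x + 1}"] by simp
qed

lemma integral_has_real_derivative_atLeast:
  assumes "continuous_on {a..} g" "x \<ge> a"
  shows "((\<lambda>x. integral {a..x} g) has_real_derivative g x) (at x within {a..})"
proof (cases "x = a")
  case True
  have "continuous_on {a..x + 1} g"
    using assms(1) by (rule continuous_on_subset) auto
  then have "((\<lambda>x. integral {a..x} g) has_real_derivative g x) (at x within {a..x + 1})"
    using assms(2) by (intro integral_has_real_derivative) auto
  moreover have "at x within {a..x + 1} = at x within {a..}"
    by (rule at_within_nhd [of _ "{..<x + 1}"]) auto
  ultimately show ?thesis by simp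
next
  case False
  then show ?thesis
    using integral_has_real_derivative_at [OF assms(1), of x] assms(2)
    by (auto intro: has_field_derivative_at_within)
qed

text \<open>Quotient rule for the unscaled form of the average; equivalently
  \<open>r avg' + N avg = h\<close>.\<close>

lemma avg_has_derivative:
  assumes "N \<ge> 1" and h: "continuous_on {0..} h" and "r > 0"
  shows "(avg N h has_real_derivative (h r - real N * avg N h r) / r) (at r)"
proof (rule has_field_derivative_transform_within_open [where S = "{0<..}"])
  let ?Y = "\<lambda>r. integral {0..r} (\<lambda>s. s ^ (N - 1) * h s)"
  have cont: "continuous_on {0..} (\<lambda>s. s ^ (N - 1) * h s)"
    by (intro continuous_intros h)
  have pow: "r ^ N = r ^ (N - 1) * r"
    using assms by (cases N) auto
  have "((\<lambda>r. ?Y r / r ^ N) has_real_derivative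
      ((r ^ (N - 1) * h r) * r ^ N - ?Y r * (real N * r ^ (N - 1))) / (r ^ N * r ^ N)) (at r)"
    using integral_has_real_derivative_at [OF cont \<open>r > 0\<close>] \<open>r > 0\<close>
    by (auto intro!: derivative_eq_intros)
  moreover have "((r ^ (N - 1) * h r) * r ^ N - ?Y r * (real N * r ^ (N - 1))) / (r ^ N * r ^ N)
      = (h r - real N * avg N h r) / r"
    unfolding avg_eq [OF assms] using \<open>r > 0\<close> by (simp add: pow divide_simps) algebra
  ultimately show "((\<lambda>r. ?Y r / r ^ N) has_real_derivative (h r - real N * avg N h r) / r) (at r)"
    by simp
qed (use assms avg_eq in auto)

lemma continuous_on_slope:
  assumes "continuous_on {0..} h"
  shows "continuous_on {0..} (slope N k h)"
  unfolding slope_def [abs_def]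
  by (intro continuous_intros continuous_on_avg assms)

lemma slope_mono:
  assumes "1 \<le> k"
    "continuous_on {0..} h" "continuous_on {0..} h'" "\<And>s. s \<ge> 0 \<Longrightarrow> h s \<le> h' s" "r \<ge> 0"
  shows "slope N k h r \<le> slope N k h' r"
  unfolding slope_def using assms
  by (intro real_root_le_mono mult_left_mono avg_mono) auto

lemma slope_nonneg:
  assumes "continuous_on {0..} h" "\<And>s. s \<ge> 0 \<Longrightarrow> h s \<ge> 0" "r \<ge> 0"
  shows "slope N k h r \<ge> 0"
  unfolding slope_def using assms
  by (intro real_root_ge_zero mult_nonneg_nonneg avg_nonneg) auto

section \<open>The integrated profile solves the radial equation and is admissible\<close>

context
  fixes N k :: nat and h :: "real \<Rightarrow> real"
  assumes k: "1 \<le> k" "k \<le> N"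
    and h: "continuous_on {0..} h" "\<And>s. s \<ge> 0 \<Longrightarrow> h s > 0"
begin

lemmas binom_pos = binom_pred_pos [OF k]

lemma slope_pos: "r \<ge> 0 \<Longrightarrow> slope N k h r > 0"
  unfolding slope_def using k binom_pos avg_pos [OF _ h, of N r]
  by (intro real_root_gt_zero mult_pos_pos divide_pos_pos) auto

lemma slope_power: 
  assumes "r \<ge> 0"
  shows "slope N k h r ^ k = real k / real ((N - 1) choose (k - 1)) * avg N h r"
  unfolding slope_def using k binom_pos avg_pos [OF _ h, of N r] assms
  by (intro real_root_pow_pos2) auto

definition curv :: "real \<Rightarrow> real" where
  "curv r = (h r - real N * avg N h r) / (real ((N - 1) choose (k - 1)) * slope N k h r ^ (k - 1))"

text \<open>In \<open>S_k\<close> the slope contributes \<open>N avg\<close> and the curvature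
  \<open>h - N avg\<close>, by the choice of the denominator in \<open>curv\<close>.\<close>

lemma radial_symm_slope:
  assumes "r \<ge> 0"
  shows "radial_symm N k (slope N k h r) (slope N k h r + curv r) = h r"
proof -
  let ?a = "slope N k h r" and ?C = "real ((N - 1) choose (k - 1))"
  have a: "?a > 0" using slope_pos assms .
  have "radial_symm N k ?a (?a + curv r) = ?C / real k * (real N * (?a ^ (k - 1) * ?a)) + ?C * ?a ^ (k - 1) * curv r"
    unfolding radial_symm_eq [OF k] using k by (simp add: field_simps)
  also have "?a ^ (k - 1) * ?a = ?a ^ k" using k by (cases k) auto
  also have "?C / real k * (real N * ?a ^ k) = real N * avg N h r"
    unfolding slope_power [OF assms] using binom_pos k by simp
  also have "?C * ?a ^ (k - 1) * curv r = h r - real N * avg N h r"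
    using a binom_pos by (simp add: curv_def)
  finally show ?thesis by simp
qed

text \<open>Positivity of \<open>h\<close> keeps the radicand away from 0, where the root may fail
  to be differentiable. Differentiating \<open>a^k = k / C avg\<close> and solving for
  \<open>r a'\<close> gives \<open>curv\<close>.\<close>

lemma slope_has_derivative:
  assumes "r > 0"
  shows "(slope N k h has_real_derivative curv r / r) (at r)"
proof -
  let ?c = "real k / real ((N - 1) choose (k - 1))"
  have pos: "?c * avg N h r > 0"
    using avg_pos [OF _ h, of N r] assms k binom_pos by simp
  have "((\<lambda>r. root k (?c * avg N h r)) has_real_derivative
      inverse (real k * root k (?c * avg N h r) ^ (k - Suc 0)) * (?c * ((h r - real N * avg N h r) / r))) (at r)"
    by (rule DERIV_chain2 [where f = "root k" and g = "\<lambda>r. ?c * avg N h r"])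
       (use k pos assms h in \<open>intro DERIV_real_root DERIV_cmult avg_has_derivative; force\<close>)+
  moreover have "inverse (real k * root k (?c * avg N h r) ^ (k - Suc 0)) * (?c * ((h r - real N * avg N h r) / r)) = curv r / r"
  proof -
    have eq: "inverse (x * A) * (x / C * (D / r)) = D / (C * A) / r"
      if "x \<noteq> 0" for x A C D :: real
      using that by (simp add: divide_inverse)
    show ?thesis
      using eq [of "real k"] k unfolding curv_def slope_def One_nat_def by auto
  qed
  ultimately show ?thesis unfolding slope_def [abs_def] by simp
qed

lemma continuous_on_curv: "continuous_on {0..} curv"
  unfolding curv_def [abs_def] 
  by (intro continuous_intros h(1) continuous_on_avg continuous_on_slope)
     (use binom_pos slope_pos in \<open>force\<close>)

text \<open>The scaled average at 0 is \<open>h 0 / N\<close>, so the numerator cancels. This is the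
  condition at the origin in \<open>radial_C2_hessian\<close>.\<close>

lemma curv_0: "curv 0 = 0"
  using k by (simp add: curv_def avg_0)

lemma rsol_has_derivative:
  assumes "r \<ge> 0"
  shows "(rsol N k h has_real_derivative r * slope N k h r) (at r within {0..})"
  unfolding rsol_def [abs_def]
  by (intro integral_has_real_derivative_atLeast assms continuous_intros continuous_on_slope h(1))

text \<open>By \<open>radial_symm_pos_mono\<close>, positivity of \<open>S_k = h\<close> already
  forces that of every lower \<open>S_j\<close>, so the cone condition follows from
  \<open>h > 0\<close>.\<close>

lemma rsol_admissible:
  fixes c :: real
  assumes N: "N = CARD('n)"
  defines "u \<equiv> (\<lambda>x :: real ^ 'n::finite. c + rsol N k h (norm x))"
  shows "u \<in> admissible k" "elem_sym k (eigenvalue_vector (hessian u x)) = h (norm x)"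
proof -
  have d: "((\<lambda>r. c + rsol N k h r) has_real_derivative r * slope N k h r) (at r within {0..})" if "r \<ge> 0" for r
    using rsol_has_derivative [OF that] by (auto intro!: derivative_eq_intros)
  note C = radial_C2_hessian [where \<phi> = "\<lambda>r. c + rsol N k h r", OF d slope_has_derivative
      continuous_on_slope [OF h(1)] continuous_on_curv curv_0]
  have hess: "hessian u x = rank_one_pert (slope N k h (norm x)) (curv (norm x)) (sgn x)" for x
    unfolding u_def by (rule C(2))
  have es: "elem_sym j (eigenvalue_vector (hessian u x)) =
      radial_symm N j (slope N k h (norm x)) (slope N k h (norm x) + curv (norm x))"
    if "1 \<le> j" "j \<le> N" for j x
  proof -
    \<comment> \<open>At the origin \<open>sgn x = 0\<close> is not a unit vector, but there the
      rank-one part vanishes and any unit vector serves.\<close>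
    obtain e :: "real ^ 'n" where e: "norm e = 1"
      and "rank_one_pert (slope N k h (norm x)) (curv (norm x)) (sgn x) =
        rank_one_pert (slope N k h (norm x)) (curv (norm x)) e"
    proof (cases "x = 0")
      case True
      fix i0 :: 'n
      show thesis by (rule that [of "axis i0 1"]) (simp_all add: True curv_0 rank_one_pert_def)
    next
      case False
      then show thesis by (intro that [of "sgn x"]) (simp_all add: norm_sgn)
    qed
    then show ?thesis
      using elem_sym_eigenvalue_vector_rank_one_pert [OF e, of j] that
      by (simp add: hess N radial_symm_def)
  qed
  show "elem_sym k (eigenvalue_vector (hessian u x)) = h (norm x)"
    using es [OF k] radial_symm_slope by simp
  have "elem_sym j (eigenvalue_vector (hessian u x)) > 0" if "j \<in> {1..k}" for j x
    using es [of j x] that k radial_symm_pos_mono [of j k N] slope_pos radial_symm_slope h(2)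
    by simp
  moreover have "u \<in> C2"
    unfolding u_def by (rule C(1))
  ultimately show "u \<in> admissible k"
    by (simp add: admissible_def Garding_cone_def)
qed

end

section \<open>Energy and Osgood estimates\<close>

lemma nn_integral_Icc_eq_integral:
  fixes f :: "real \<Rightarrow> real"
  assumes "continuous_on {a..b} f" "\<And>x. x \<in> {a..b} \<Longrightarrow> f x \<ge> 0"
  shows "(\<lambda>x. ennreal (f x) * indicator {a..b} x) \<in> borel_measurable lborel"
    and "(\<integral>\<^sup>+x\<in>{a..b}. ennreal (f x) \<partial>lborel) = ennreal (integral {a..b} f)"
proof -
  have si: "set_integrable lborel {a..b} f"
    using assms(1) by (rule borel_integrable_atLeastAtMost')
  have eq: "(\<lambda>x. ennreal (f x) * indicator {a..b} x) = (\<lambda>x. ennreal (indicator {a..b} x *\<^sub>R f x))"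
    by (auto simp: fun_eq_iff split: split_indicator)
  have int: "integrable lborel (\<lambda>x. indicator {a..b} x *\<^sub>R f x)"
    using si by (simp add: set_integrable_def)
  then show "(\<lambda>x. ennreal (f x) * indicator {a..b} x) \<in> borel_measurable lborel"
    unfolding eq by measurable
  show "(\<integral>\<^sup>+x\<in>{a..b}. ennreal (f x) \<partial>lborel) = ennreal (integral {a..b} f)"
    unfolding eq set_borel_integral_eq_integral(2) [OF si, symmetric] set_lebesgue_integral_def
    by (rule nn_integral_eq_integral [OF int])
       (use assms(2) in \<open>auto split: split_indicator\<close>)
qed

text \<open>Divergence is stated with Lebesgue integrals over a half-line, whereas the estimates use
  \<open>integral {a..T}\<close>. Monotone convergence along \<open>[a, a + n]\<close> would turn a
  common bound \<open>M\<close> into a bound for the whole.\<close>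

lemma integral_unbounded_if_nn_integral_infinite:
  fixes f :: "real \<Rightarrow> real"
  assumes f: "continuous_on {a..} f" "\<And>x. x \<ge> a \<Longrightarrow> f x \<ge> 0"
    and inf: "(\<integral>\<^sup>+x\<in>{a..}. ennreal (f x) \<partial>lborel) = \<infinity>"
  obtains T where "T \<ge> a" "integral {a..T} f > M"
proof (rule ccontr)
  assume *: "\<not> thesis"
  have cont: "continuous_on {a..a + real n} f" for n
    using f(1) by (rule continuous_on_subset) auto
  have le: "integral {a..T} f \<le> M" if "T \<ge> a" for T
    using * that \<open>\<And>T. T \<ge> a \<Longrightarrow> integral {a..T} f > M \<Longrightarrow> thesis\<close> by force
  have "(\<integral>\<^sup>+x\<in>{a..}. ennreal (f x) \<partial>lborel) =
      (\<integral>\<^sup>+x. (SUP n. ennreal (f x) * indicator {a..a + real n} x) \<partial>lborel)"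
  proof (rule nn_integral_cong)
    fix x
    have "(SUP n::nat. indicator {a..a + real n} x) = (indicator {a..} x :: ennreal)"
    proof (cases "x \<ge> a")
      case True
      obtain n :: nat where "x - a \<le> real n" using real_arch_simple by blast
      with True show ?thesis
        by (intro antisym SUP_least SUP_upper2 [of n]) (auto split: split_indicator)
    qed (auto simp: indicator_def)
    then show "ennreal (f x) * indicator {a..} x = (SUP n. ennreal (f x) * indicator {a..a + real n} x)"
      by (simp add: SUP_mult_left_ennreal [symmetric])
  qed
  also have "\<dots> = (SUP n. \<integral>\<^sup>+x. ennreal (f x) * indicator {a..a + real n} x \<partial>lborel)"
    by (intro nn_integral_monotone_convergence_SUP nn_integral_Icc_eq_integral(1) cont)
       (use f(2) in \<open>auto simp: incseq_def le_fun_def split: split_indicator\<close>)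
  also have "\<dots> = (SUP n. ennreal (integral {a..a + real n} f))"
    using nn_integral_Icc_eq_integral(2) [OF cont] f(2) by simp
  also have "\<dots> \<le> ennreal M"
    by (intro SUP_least ennreal_leI le) simp
  finally show False using inf by (simp add: top_unique)
qed

lemma integral_bounded_if_nn_integral_finite:
  fixes f :: "real \<Rightarrow> real"
  assumes f: "continuous_on {a..} f" "\<And>x. x \<ge> a \<Longrightarrow> f x \<ge> 0"
    and fin: "(\<integral>\<^sup>+x\<in>{a..}. ennreal (f x) \<partial>lborel) < \<infinity>"
  obtains M where "\<And>T. T \<ge> a \<Longrightarrow> integral {a..T} f \<le> M"
proof
  fix T assume "T \<ge> a"
  have "continuous_on {a..T} f"
    using f(1) by (rule continuous_on_subset) auto
  then have "ennreal (integral {a..T} f) = (\<integral>\<^sup>+x\<in>{a..T}. ennreal (f x) \<partial>lborel)"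
    using nn_integral_Icc_eq_integral(2) f(2) by simp
  also have "\<dots> \<le> (\<integral>\<^sup>+x\<in>{a..}. ennreal (f x) \<partial>lborel)"
    by (intro nn_integral_mono) (auto split: split_indicator)
  also have "\<dots> = ennreal (enn2real \<dots>)"
    using fin by simp
  finally show "integral {a..T} f \<le> enn2real (\<integral>\<^sup>+x\<in>{a..}. ennreal (f x) \<partial>lborel)"
    by (simp add: ennreal_le_iff)
qed

text \<open>With \<open>\<Phi>\<close> the primitive of \<open>1 / G\<close> starting at 1, the
  inequality says \<open>(\<Phi> (W r))' \<le> \<theta> r\<close>, so
  \<open>\<Theta> r - \<Phi> (W r)\<close> is nondecreasing. The bound \<open>T\<close> depends on
  \<open>W\<close> only through \<open>W r0\<close>, which makes it uniform over families of
  functions.\<close>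

lemma osgood_bound:
  fixes G :: "real \<Rightarrow> real"
  assumes G: "continuous_on {1..} G" "\<And>t. t \<ge> 1 \<Longrightarrow> G t > 0"
    and r: "r0 \<le> r1" and W: "continuous_on {r0..r1} W" and \<Theta>: "continuous_on {r0..r1} \<Theta>"
    and W1: "\<And>r. r \<in> {r0..r1} \<Longrightarrow> W r > 1"
    and dW: "\<And>r. r \<in> {r0<..<r1} \<Longrightarrow> (W has_real_derivative W' r) (at r)"
    and d\<Theta>: "\<And>r. r \<in> {r0<..<r1} \<Longrightarrow> (\<Theta> has_real_derivative \<theta> r) (at r)"
    and le: "\<And>r. r \<in> {r0<..<r1} \<Longrightarrow> W' r \<le> \<theta> r * G (W r)"
    and T: "integral {1..W r0} (\<lambda>t. 1 / G t) + \<Theta> r1 - \<Theta> r0 < integral {1..T} (\<lambda>t. 1 / G t)"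
  shows "W r1 \<le> T"
proof (rule ccontr)
  assume "\<not> W r1 \<le> T"
  have cont: "continuous_on {1..} (\<lambda>t. 1 / G t)"
    by (intro continuous_intros G ballI) (metis G(2) atLeast_iff less_irrefl)
  have nonneg: "1 / G t \<ge> 0" if "t \<ge> 1" for t
    using G(2) [OF that] by simp
  define \<Phi> where "\<Phi> t = integral {1..t} (\<lambda>t. 1 / G t)" for t
  have d\<Phi>: "(\<Phi> has_real_derivative 1 / G t) (at t)" if "t > 1" for t
    unfolding \<Phi>_def [abs_def] using integral_has_real_derivative_at [OF cont that] .
  have int: "(\<lambda>t. 1 / G t) integrable_on {1..s}" for s
    by (intro integrable_continuous_real continuous_on_subset [OF cont]) auto
  have "\<Theta> r0 - \<Phi> (W r0) \<le> \<Theta> r1 - \<Phi> (W r1)"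
  proof (rule DERIV_nonneg_imp_increasing_open [OF r])
    have "continuous_on {1<..} \<Phi>"
      using d\<Phi> by (auto intro!: DERIV_continuous_on [of _ _ "\<lambda>t. 1 / G t"] intro: has_field_derivative_at_within)
    then show "continuous_on {r0..r1} (\<lambda>r. \<Theta> r - \<Phi> (W r))"
      using W1 by (intro continuous_intros \<Theta> continuous_on_compose2 [of "{1<..}" \<Phi>, OF _ W]) auto
    fix r assume "r0 < r" "r < r1"
    then have r: "r \<in> {r0<..<r1}" and W1r: "W r > 1" using W1 by auto
    have "((\<lambda>r. \<Theta> r - \<Phi> (W r)) has_real_derivative \<theta> r - 1 / G (W r) * W' r) (at r)"
      by (intro DERIV_diff d\<Theta> r DERIV_chain2 [where f = \<Phi> and g = W, OF d\<Phi> [OF W1r] dW [OF r]])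
    moreover have "\<theta> r - 1 / G (W r) * W' r \<ge> 0"
      using le [OF r] G(2) [of "W r"] W1r by (simp add: field_simps)
    ultimately show "\<exists>y. ((\<lambda>r. \<Theta> r - \<Phi> (W r)) has_real_derivative y) (at r) \<and> y \<ge> 0"
      by blast
  qed
  then have "\<Phi> (W r1) < \<Phi> T"
    using T by (simp add: \<Phi>_def)
  moreover have "\<Phi> T \<le> \<Phi> (W r1)"
    unfolding \<Phi>_def using \<open>\<not> W r1 \<le> T\<close> nonneg by (intro integral_subset_le int) auto
  ultimately show False by simp
qed

section \<open>Weighted energy inequality, and determination of an admissible radial function by its
  source\<close>

context
  fixes N k :: nat and h :: "real \<Rightarrow> real"
  assumes k: "1 \<le> k" "k \<le> N"
    and h: "continuous_on {0..} h" "\<And>s. s \<ge> 0 \<Longrightarrow> h s > 0"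
begin

text \<open>Used with \<open>\<omega> = 1\<close> for the a priori bound and with \<open>\<omega> r = r\<^bsup>N/k-1\<^esup>\<close>, the extreme case of the
  differential inequality for \<open>\<omega>\<close>, at infinity.\<close>

lemma energy_estimate:
  assumes r: "0 \<le> r0" "r0 \<le> r1"
    and \<omega>: "continuous_on {r0..r1} \<omega>" "\<And>r. r \<in> {r0<..<r1} \<Longrightarrow> \<omega> r \<ge> 0"
      "\<And>r. r \<in> {r0<..<r1} \<Longrightarrow> (\<omega> has_real_derivative \<omega>' r) (at r)"
      "\<And>r. r \<in> {r0<..<r1} \<Longrightarrow> r * \<omega>' r \<le> (real N / real k - 1) * \<omega> r"
    and E: "continuous_on {r0..r1} E"
      "\<And>r. r \<in> {r0<..<r1} \<Longrightarrow> (E has_real_derivative E' r) (at r)"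
      "\<And>r. r \<in> {r0<..<r1} \<Longrightarrow>
         real (k + 1) / real ((N - 1) choose (k - 1)) * \<omega> r ^ (k + 1) * r ^ (k - 1) * h r * (r * slope N k h r) \<le> E' r"
  shows "(\<omega> r1 * (r1 * slope N k h r1)) ^ (k + 1) - (\<omega> r0 * (r0 * slope N k h r0)) ^ (k + 1) \<le> E r1 - E r0"
proof -
  let ?a = "slope N k h" and ?b = "curv N k h" and ?C = "real ((N - 1) choose (k - 1))"
  let ?e = "\<lambda>r. (\<omega> r * (r * ?a r)) ^ (k + 1)"
  have "E r0 - ?e r0 \<le> E r1 - ?e r1"
  proof (rule DERIV_nonneg_imp_increasing_open [OF r(2)])
    have "continuous_on {r0..r1} ?a"
      using continuous_on_slope [OF h(1)] by (rule continuous_on_subset) (use r in auto)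
    then show "continuous_on {r0..r1} (\<lambda>r. E r - ?e r)"
      by (intro continuous_intros E \<omega>)
    fix r assume "r0 < r" "r < r1"
    then have rr: "r \<in> {r0<..<r1}" and "r > 0" using r by auto
    have a: "?a r > 0" using slope_pos [OF k h] \<open>r > 0\<close> by simp
    have C: "?C > 0" using binom_pred_pos [OF k] .
    have da: "(?a has_real_derivative ?b r / r) (at r)"
      using slope_has_derivative [OF k h \<open>r > 0\<close>] .
    let ?d = "\<omega>' r * (r * ?a r) + \<omega> r * (?a r + ?b r)"
    have "((\<lambda>r. \<omega> r * (r * ?a r)) has_real_derivative ?d) (at r)"
      using \<omega>(3) [OF rr] da \<open>r > 0\<close> by (auto intro!: derivative_eq_intros simp: field_simps)
    from DERIV_diff [OF E(2) [OF rr] DERIV_power [OF this, of "k + 1"]]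
    have "((\<lambda>r. E r - ?e r) has_real_derivative
        E' r - real (k + 1) * ?d * (\<omega> r * (r * ?a r)) ^ k) (at r)"
      by (simp only: add_diff_cancel_right' One_nat_def [symmetric] mult.assoc)
    moreover have "real (k + 1) * ?d * (\<omega> r * (r * ?a r)) ^ k \<le> E' r"
    proof -
      \<comment> \<open>The hypothesis on \<open>\<omega>\<close> trades \<open>r \<omega>'\<close>
        for \<open>(N/k - 1) \<omega>\<close>. What remains is the combination
        \<open>N/k a + b\<close>, which is what \<open>S_k\<close> contains besides its factor
        \<open>C a^(k-1)\<close>.\<close>
      have "?d \<le> \<omega> r * (real N / real k * ?a r + ?b r)"
        using mult_right_mono [OF \<omega>(4) [OF rr], of "?a r"] a by (simp add: algebra_simps)
      then have "real (k + 1) * ?d * (\<omega> r * (r * ?a r)) ^ k \<le>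
          real (k + 1) * (\<omega> r * (real N / real k * ?a r + ?b r)) * (\<omega> r * (r * ?a r)) ^ k"
        using \<omega>(2) [OF rr] a \<open>r > 0\<close> by (intro mult_right_mono mult_left_mono) auto
      also have "\<dots> = real (k + 1) * \<omega> r ^ (k + 1) * r ^ k * ?a r *
          (?a r ^ (k - 1) * (real N / real k * ?a r + ?b r))"
        using k by (cases k) (simp_all add: power_mult_distrib)
      also have "?a r ^ (k - 1) * (real N / real k * ?a r + ?b r) = h r / ?C"
      proof -
        have "h r = ?C * (?a r ^ (k - 1) * (real N / real k * ?a r + ?b r))"
          using radial_symm_slope [OF k h less_imp_le [OF \<open>r > 0\<close>]] k
          unfolding radial_symm_eq [OF k] by (simp add: field_simps)
        then show ?thesis using C by simp
      qed
      also have "real (k + 1) * \<omega> r ^ (k + 1) * r ^ k * ?a r * (h r / ?C) =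
          real (k + 1) / ?C * \<omega> r ^ (k + 1) * r ^ (k - 1) * h r * (r * ?a r)"
        using k by (cases k) simp_all
      also have "\<dots> \<le> E' r" using E(3) [OF rr] .
      finally show ?thesis .
    qed
    ultimately show "\<exists>y. ((\<lambda>r. E r - ?e r) has_real_derivative y) (at r) \<and> y \<ge> 0"
      by (intro exI [of _ "E' r - real (k + 1) * ?d * (\<omega> r * (r * ?a r)) ^ k"]) simp
  qed
  then show ?thesis by simp
qed

text \<open>Converse of \<open>rsol_admissible\<close>: \<open>S_1 > 0\<close> makes the profile
  increasing, and then the divergence form of \<open>S_k\<close> can be integrated from 0 and solved
  for \<open>\<phi>'\<close>.\<close>

lemma radial_admissible_eq_rsol:
  fixes u :: "real ^ 'n::finite \<Rightarrow> real"
  assumes N: "N = CARD('n)" and u: "u \<in> admissible k" "radial u"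
    and eq: "\<And>x. elem_sym k (eigenvalue_vector (hessian u x)) = h (norm x)"
  shows "u x = u 0 + rsol N k h (norm x)"
proof -
  have "u \<in> C2" using u(1) by (simp add: admissible_def)
  obtain \<phi> d d2 where \<phi>: "\<And>x. u x = \<phi> (norm x)"
    and d: "\<And>r. (\<phi> has_real_derivative d r) (at r)"
    and d0: "d 0 = 0" and d2: "\<And>r. (d has_real_derivative d2 r) (at r)"
    and hess: "\<And>x. x \<noteq> 0 \<Longrightarrow> hessian u x = 
         rank_one_pert (d (norm x) / norm x) (d2 (norm x) - d (norm x) / norm x) (sgn x)"
    by (rule radial_C2_E [OF \<open>u \<in> C2\<close> u(2)]) (rule that)
  let ?C = "real ((N - 1) choose (k - 1))"
  have C: "?C > 0" using binom_pred_pos [OF k] .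
  have contd: "continuous_on S d" for S
    using d2 by (intro DERIV_continuous_on [of _ _ d2]) (auto intro: has_field_derivative_at_within)
  have es: "\<exists>x. norm x = r \<and> elem_sym j (eigenvalue_vector (hessian u x)) = radial_symm N j (d r / r) (d2 r)"
    if "r > 0" "1 \<le> j" "j \<le> N" for r j
  proof -
    fix i0 :: 'n
    let ?x = "r *\<^sub>R axis i0 1 :: real^'n"
    have x: "norm ?x = r" "?x \<noteq> 0" using that by auto
    then have "norm (sgn ?x) = 1" by (simp add: norm_sgn)
    then have "elem_sym j (eigenvalue_vector (hessian u ?x)) = radial_symm N j (d r / r) (d2 r)"
      using elem_sym_eigenvalue_vector_rank_one_pert [of "sgn ?x" j "d r / r" "d2 r - d r / r"] that(2,3)
      unfolding hess [OF x(2)] x(1) N by (simp add: radial_symm_def)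
    with x(1) show ?thesis by blast
  qed
  have dpos: "d r > 0" if "r > 0" for r
  proof -
    \<comment> \<open>\<open>S_1\<close> is \<open>(N - 1) \<phi>' / r + \<phi>''\<close>, so
      \<open>r^(N-1) \<phi>'\<close> has derivative \<open>r^(N-1) S_1 > 0\<close>; it vanishes at 0
      because \<open>d 0 = 0\<close>.\<close>
    have "0 ^ (N - 1) * d 0 < r ^ (N - 1) * d r"
    proof (rule DERIV_pos_imp_increasing_open [OF that])
      show "continuous_on {0..r} (\<lambda>r. r ^ (N - 1) * d r)"
        by (intro continuous_intros contd)
      fix s :: real assume s: "0 < s" "s < r"
      obtain x :: "real^'n" where "elem_sym 1 (eigenvalue_vector (hessian u x)) = radial_symm N 1 (d s / s) (d2 s)"
        using es [of s 1] s k by auto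
      moreover have "elem_sym 1 (eigenvalue_vector (hessian u x)) > 0"
        using u(1) k by (auto simp: admissible_def Garding_cone_def)
      ultimately have pos: "real (N - 1) * (d s / s) + d2 s > 0"
        by (simp add: radial_symm_def)
      have "((\<lambda>r. r ^ (N - 1) * d r) has_real_derivative
          real (N - 1) * s ^ (N - 1 - 1) * d s + s ^ (N - 1) * d2 s) (at s)"
        using d2 [of s] by (auto intro!: derivative_eq_intros)
      moreover have "real (N - 1) * s ^ (N - 1 - 1) * d s + s ^ (N - 1) * d2 s =
          s ^ (N - 1) * (real (N - 1) * (d s / s) + d2 s)"
        using s by (cases "N - 1") (simp_all add: field_simps)
      ultimately show "\<exists>y. ((\<lambda>r. r ^ (N - 1) * d r) has_real_derivative y) (at s) \<and> 0 < y"
        using pos s by (intro exI [of _ "s ^ (N - 1) * (real (N - 1) * (d s / s) + d2 s)"]) simp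
    qed
    then show ?thesis using d0 that by (simp add: zero_less_mult_iff)
  qed
  have slope: "d r = r * slope N k h r" if "r \<ge> 0" for r
  proof (cases "r = 0")
    case False
    with that have "r > 0" by simp
    \<comment> \<open>This form is continuous up to 0, as the fundamental theorem requires; for
      \<open>s > 0\<close> it is rewritten through \<open>d s / s\<close>, which is the variable of
      \<open>radial_symm\<close>.\<close>
    let ?Z = "\<lambda>r. r ^ (N - k) * d r ^ k"
    have Z: "?Z s = s ^ N * (d s / s) ^ k" if "s > 0" for s
      using that k by (simp add: power_divide power_diff)
    have "((\<lambda>s. real k / ?C * (s ^ (N - 1) * h s)) has_integral ?Z r - ?Z 0) {0..r}"
    proof (rule fundamental_theorem_of_calculus_interior)
      show "continuous_on {0..r} ?Z"
        by (intro continuous_intros contd)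
      fix s assume "s \<in> {0<..<r}"
      then have s: "s > 0" by simp
      have "((\<lambda>s. d s / s) has_real_derivative (d2 s - d s / s) / s) (at s)"
        using d2 [of s] s by (auto intro!: derivative_eq_intros simp: field_simps)
      from DERIV_mult [OF DERIV_pow [of N] DERIV_power [OF this, of k]]
      have "((\<lambda>s. s ^ N * (d s / s) ^ k) has_real_derivative
          real N * s ^ (N - 1) * (d s / s) ^ k +
          s ^ N * (real k * (d s / s) ^ (k - 1) * ((d2 s - d s / s) / s))) (at s)"
        by (simp only: One_nat_def ac_simps)
      moreover have "real N * s ^ (N - 1) * (d s / s) ^ k +
          s ^ N * (real k * (d s / s) ^ (k - 1) * ((d2 s - d s / s) / s)) =
          real k / ?C * (s ^ (N - 1) * h s)"
      proof -
        have hs: "h s = ?C / real k * (d s / s) ^ (k - 1) * ((real N - real k) * (d s / s) + real k * d2 s)"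
          using es [of s k] s k eq radial_symm_eq [OF k] by auto
        have 1: "s ^ N = s ^ (N - 1) * s" using k by (cases N) auto
        have 2: "(d s / s) ^ k = (d s / s) ^ (k - 1) * (d s / s)" for s using k by (cases k) auto
        have alg: "n * S * (P * \<alpha>) + S * s * (x * P * ((\<mu> - \<alpha>) / s)) = x / C * (S * (C / x * P * ((n - x) * \<alpha> + x * \<mu>)))"
          if "x \<noteq> 0" "C \<noteq> 0" for n x C S P \<alpha> \<mu> :: real
          using that s by (simp add: field_simps)
        show ?thesis
          unfolding hs 1 2 using k C by (intro alg) auto
      qed
      ultimately have "((\<lambda>s. s ^ N * (d s / s) ^ k) has_real_derivative real k / ?C * (s ^ (N - 1) * h s)) (at s)"
        by simp
      then have "(?Z has_real_derivative real k / ?C * (s ^ (N - 1) * h s)) (at s)"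
        by (rule has_field_derivative_transform_within_open [where S = "{0<..}"]) (use s Z in auto)
      then show "(?Z has_vector_derivative real k / ?C * (s ^ (N - 1) * h s)) (at s)"
        by (simp add: has_real_derivative_iff_has_vector_derivative)
    qed (use \<open>r > 0\<close> in simp)
    from integral_unique [OF this] have "?Z r = real k / ?C * integral {0..r} (\<lambda>s. s ^ (N - 1) * h s)"
      using d0 k by simp
    moreover have "integral {0..r} (\<lambda>s. s ^ (N - 1) * h s) = r ^ N * avg N h r"
      using avg_eq [OF _ h(1) \<open>r > 0\<close>, of N] k \<open>r > 0\<close> by simp
    ultimately have "r ^ N * (d r / r) ^ k = r ^ N * (real k / ?C * avg N h r)"
      unfolding Z [OF \<open>r > 0\<close>] by simp
    then have "(d r / r) ^ k = real k / ?C * avg N h r"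
      by (rule mult_left_cancel [THEN iffD1, rotated]) (use \<open>r > 0\<close> in simp)
    then have "slope N k h r = root k ((d r / r) ^ k)"
      by (simp add: slope_def)
    \<comment> \<open>For even \<open>k\<close> the power determines \<open>\<phi>' / r\<close> only
      up to sign; \<open>dpos\<close> selects the positive value.\<close>
    also have "\<dots> = d r / r"
      using dpos [OF \<open>r > 0\<close>] \<open>r > 0\<close> k by (intro real_root_power_cancel) auto
    finally show ?thesis using \<open>r > 0\<close> by simp
  qed (simp add: d0)
  have "((\<lambda>s. s * slope N k h s) has_integral \<phi> (norm x) - \<phi> 0) {0..norm x}"
  proof (rule fundamental_theorem_of_calculus)
    fix s assume "s \<in> {0..norm x}"
    then have "(\<phi> has_real_derivative s * slope N k h s) (at s)"
      using d [of s] slope [of s] by simp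
    then show "(\<phi> has_vector_derivative s * slope N k h s) (at s within {0..norm x})"
      by (simp add: has_field_derivative_at_within flip: has_real_derivative_iff_has_vector_derivative)
  qed simp
  then show ?thesis
    using \<phi> [of x] \<phi> [of 0] by (simp add: rsol_def integral_unique)
qed

end

section \<open>The nonlinearities on the diagonal, their primitive and the Keller-Osserman
  integral\<close>

lemma nonlinearity_continuous_on:
  assumes "nonlinearity f" "continuous_on S u" "continuous_on S v"
    and "\<And>x. x \<in> S \<Longrightarrow> u x \<ge> 0" "\<And>x. x \<in> S \<Longrightarrow> v x \<ge> 0"
  shows "continuous_on S (\<lambda>x. f (u x) (v x))"
proof -
  have "continuous_on ({0..} \<times> {0..}) (\<lambda>(s, t). f s t)"
    using assms(1) by (simp add: nonlinearity_def)
  from continuous_on_compose2 [OF this continuous_on_Pair [OF assms(2,3)]]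
  show ?thesis using assms(4,5) by auto
qed

lemma nonlinearity_nonneg: "nonlinearity f \<Longrightarrow> s \<ge> 0 \<Longrightarrow> t \<ge> 0 \<Longrightarrow> f s t \<ge> 0"
  by (simp add: nonlinearity_def)

lemma nonlinearity_pos: "nonlinearity f \<Longrightarrow> s > 0 \<Longrightarrow> t > 0 \<Longrightarrow> f s t > 0"
  by (simp add: nonlinearity_def)

lemma nonlinearity_mono:
  assumes "nonlinearity f" "0 \<le> s" "s \<le> s'" "0 \<le> t" "t \<le> t'"
  shows "f s t \<le> f s' t'"
proof -
  have "f s t \<le> f s' t"
    using assms by (auto simp: nonlinearity_def dest!: spec [of _ t] intro: mono_onD)
  also have "\<dots> \<le> f s' t'"
    using assms by (auto simp: nonlinearity_def dest!: spec [of _ s'] intro: mono_onD)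
  finally show ?thesis .
qed

context
  fixes k :: nat and f g :: "real \<Rightarrow> real \<Rightarrow> real"
  assumes f: "nonlinearity f" and g: "nonlinearity g"
begin

definition diag :: "real \<Rightarrow> real" where
  "diag z = f z z ^ k + g z z ^ k"

lemma continuous_on_diag: "continuous_on {0..} diag"
  unfolding diag_def [abs_def]
  by (intro continuous_intros nonlinearity_continuous_on [OF f] nonlinearity_continuous_on [OF g]) auto

lemma diag_nonneg: "z \<ge> 0 \<Longrightarrow> diag z \<ge> 0"
  using nonlinearity_nonneg [OF f] nonlinearity_nonneg [OF g] by (simp add: diag_def)

lemma diag_pos: "z > 0 \<Longrightarrow> diag z > 0"
  using nonlinearity_pos [OF f] nonlinearity_pos [OF g] by (simp add: diag_def add_pos_pos)

text \<open>Raising both arguments to \<open>s + t\<close> reduces the coupled system to one scalar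
  inequality for the sum of the two components.\<close>

lemma diag_ge:
  assumes "0 \<le> s" "0 \<le> t"
  shows "f s t ^ k \<le> diag (s + t)" "g s t ^ k \<le> diag (s + t)"
proof -
  have "f s t ^ k \<le> f (s + t) (s + t) ^ k" "g s t ^ k \<le> g (s + t) (s + t) ^ k"
    using assms nonlinearity_mono [OF f] nonlinearity_mono [OF g]
      nonlinearity_nonneg [OF f] nonlinearity_nonneg [OF g]
    by (auto intro!: power_mono)
  moreover have "f (s + t) (s + t) ^ k \<ge> 0" "g (s + t) (s + t) ^ k \<ge> 0"
    using assms nonlinearity_nonneg [OF f] nonlinearity_nonneg [OF g] by simp_all
  ultimately show "f s t ^ k \<le> diag (s + t)" "g s t ^ k \<le> diag (s + t)"
    unfolding diag_def by linarith+
qed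

abbreviation F :: "real \<Rightarrow> real" where "F \<equiv> primitive_F k f g"

lemma F_eq: "F = (\<lambda>t. integral {0..t} diag)"
  by (simp add: primitive_F_def diag_def [abs_def] fun_eq_iff)

lemma F_has_derivative: "t > 0 \<Longrightarrow> (F has_real_derivative diag t) (at t)"
  unfolding F_eq using integral_has_real_derivative_at [OF continuous_on_diag] .

lemma continuous_on_F: "continuous_on {0<..} F"
  using F_has_derivative
  by (auto intro!: DERIV_continuous_on [of _ _ diag] intro: has_field_derivative_at_within)

lemma F_mono: "s \<le> t \<Longrightarrow> F s \<le> F t"
  unfolding F_eq
  by (intro integral_subset_le integrable_continuous_real continuous_on_subset [OF continuous_on_diag])
     (auto intro: diag_nonneg)

lemma F_nonneg: "F t \<ge> 0"
  unfolding F_eq 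
  by (intro integral_nonneg integrable_continuous_real continuous_on_subset [OF continuous_on_diag])
     (auto intro: diag_nonneg)

lemma F_pos: 
  assumes "t > 0"
  shows "F t > 0"
proof -
  have "F (t / 2) < F t"
  proof (rule DERIV_pos_imp_increasing [where f = F])
    fix x assume "t / 2 \<le> x"
    with assms have "x > 0" by simp
    then show "\<exists>y. (F has_real_derivative y) (at x) \<and> 0 < y"
      using F_has_derivative diag_pos by blast
  qed (use assms in simp)
  with F_nonneg [of "t / 2"] show ?thesis by simp
qed

text \<open>The denominator of the Keller-Osserman integrand; it plays the part of \<open>G\<close>
  in \<open>osgood_bound\<close>.\<close>

definition KO_root :: "real \<Rightarrow> real" where
  "KO_root t = root (k + 1) (real (k + 1) * F t)"

lemma continuous_on_KO_root: "continuous_on {1..} KO_root"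
  unfolding KO_root_def [abs_def]
  by (intro continuous_intros continuous_on_subset [OF continuous_on_F]) auto

lemma KO_root_pos: "t > 0 \<Longrightarrow> KO_root t > 0"
  unfolding KO_root_def using F_pos by (intro real_root_gt_zero mult_pos_pos) auto

lemma KO_integral_unbounded:
  assumes "keller_osserman_integral k f g = \<infinity>"
  obtains T where "integral {1..T} (\<lambda>t. 1 / KO_root t) > M"
proof -
  have "continuous_on {1..} (\<lambda>t. 1 / KO_root t)"
    by (intro continuous_intros continuous_on_KO_root ballI)
       (metis KO_root_pos atLeast_iff less_le_trans less_irrefl zero_less_one)
  moreover have "1 / KO_root t \<ge> 0" if "t \<ge> 1" for t
    using KO_root_pos [of t] that by simp
  moreover have "(\<integral>\<^sup>+t\<in>{1..}. ennreal (1 / KO_root t) \<partial>lborel) = \<infinity>"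
    using assms by (simp add: keller_osserman_integral_def KO_root_def)
  ultimately show thesis
    by (rule integral_unbounded_if_nn_integral_infinite) (assumption, rule that)
qed

text \<open>The energy estimate with \<open>E = B (k + 1) F (W)\<close>. \<open>W\<close> stands for
  the sum of both profiles, so \<open>W'\<close> dominates the derivative of each single one, and
  the upper bound \<open>B diag (W)\<close> times \<open>W'\<close> is the derivative of
  \<open>B F (W)\<close>.\<close>

lemma growth_estimate:
  assumes k: "1 \<le> k" "k \<le> N" and h: "continuous_on {0..} h" "\<And>s. s \<ge> 0 \<Longrightarrow> h s > 0"
    and r: "0 \<le> r0" "r0 \<le> r1" and B: "B \<ge> 0"
    and \<omega>: "continuous_on {r0..r1} \<omega>" "\<And>r. r \<in> {r0<..<r1} \<Longrightarrow> \<omega> r \<ge> 0"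
      "\<And>r. r \<in> {r0<..<r1} \<Longrightarrow> (\<omega> has_real_derivative \<omega>' r) (at r)"
      "\<And>r. r \<in> {r0<..<r1} \<Longrightarrow> r * \<omega>' r \<le> (real N / real k - 1) * \<omega> r"
    and W: "continuous_on {r0..r1} W" "\<And>r. r \<in> {r0..r1} \<Longrightarrow> W r > 0"
      "\<And>r. r \<in> {r0<..<r1} \<Longrightarrow> (W has_real_derivative W' r) (at r)"
      "\<And>r. r \<in> {r0<..<r1} \<Longrightarrow> r * slope N k h r \<le> W' r"
    and le: "\<And>r. r \<in> {r0<..<r1} \<Longrightarrow> 
       1 / real ((N - 1) choose (k - 1)) * \<omega> r ^ (k + 1) * r ^ (k - 1) * h r \<le> B * diag (W r)"
  shows "(\<omega> r1 * (r1 * slope N k h r1)) ^ (k + 1) \<le>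
           (\<omega> r0 * (r0 * slope N k h r0)) ^ (k + 1) + B * (real (k + 1) * F (W r1))"
proof -
  let ?E = "\<lambda>r. B * (real (k + 1) * F (W r))" and ?E' = "\<lambda>r. B * (real (k + 1) * (diag (W r) * W' r))"
  have "(\<omega> r1 * (r1 * slope N k h r1)) ^ (k + 1) - (\<omega> r0 * (r0 * slope N k h r0)) ^ (k + 1)
      \<le> ?E r1 - ?E r0"
  proof (rule energy_estimate [OF k h r \<omega>])
    show "continuous_on {r0..r1} ?E"
      using W(2) by (intro continuous_intros continuous_on_compose2 [OF continuous_on_F W(1)]) auto
  next
    fix r assume r': "r \<in> {r0<..<r1}"
    then have Wr: "W r > 0" using W(2) by simp
    show "(?E has_real_derivative ?E' r) (at r)"
      by (intro DERIV_cmult DERIV_chain2 [where f = F and g = W, OF F_has_derivative [OF Wr] W(3) [OF r']])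
    have s: "r * slope N k h r \<ge> 0"
      using slope_nonneg [OF h(1)] h(2) r' r by (simp add: less_imp_le)
    have "real (k + 1) / real ((N - 1) choose (k - 1)) * \<omega> r ^ (k + 1) * r ^ (k - 1) * h r * (r * slope N k h r) =
      real (k + 1) * ((1 / real ((N - 1) choose (k - 1)) * \<omega> r ^ (k + 1) * r ^ (k - 1) * h r) * (r * slope N k h r))"
      by simp
    also have "\<dots> \<le> real (k + 1) * ((B * diag (W r)) * W' r)"
      using s B diag_nonneg [of "W r"] Wr
      by (intro mult_left_mono [OF mult_mono [OF le [OF r'] W(4) [OF r']]]) auto
    finally show "real (k + 1) / real ((N - 1) choose (k - 1)) * \<omega> r ^ (k + 1) * r ^ (k - 1) * h r * (r * slope N k h r) \<le> ?E' r"
      by (simp add: mult_ac)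
  qed
  moreover have "?E r0 \<ge> 0" using B F_nonneg by simp
  ultimately show ?thesis by simp
qed

end

section \<open>Limits and monotonicity of the radial solution operator\<close>

lemma rsol_tendsto:
  assumes k: "1 \<le> k" "k \<le> N"
    and cont: "\<And>n. continuous_on {0..} (h n)" "continuous_on {0..} h'"
    and nonneg: "\<And>n s. s \<ge> 0 \<Longrightarrow> h n s \<ge> 0" and le: "\<And>n s. s \<ge> 0 \<Longrightarrow> h n s \<le> h' s"
    and lim: "\<And>s. s \<ge> 0 \<Longrightarrow> (\<lambda>n. h n s) \<longlonglongrightarrow> h' s" and "r \<ge> 0"
  shows "(\<lambda>n. rsol N k (h n) r) \<longlonglongrightarrow> rsol N k h' r"
proof -
  have avg: "(\<lambda>n. avg N (h n) r) \<longlonglongrightarrow> avg N h' r" if "r \<ge> 0" for r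
    unfolding avg_def
  proof (rule dominated_convergence(2))
    show "(\<lambda>\<tau>. \<tau> ^ (N - 1) * h n (r * \<tau>)) integrable_on {0..1}" for n
      using avg_integrand_integrable [OF cont(1) that] .
    show "(\<lambda>\<tau>. \<tau> ^ (N - 1) * h' (r * \<tau>)) integrable_on {0..1}"
      using avg_integrand_integrable [OF cont(2) that] .
  qed (use that nonneg le in \<open>auto intro!: tendsto_mult lim mult_left_mono\<close>)
  have slope: "(\<lambda>n. slope N k (h n) r) \<longlonglongrightarrow> slope N k h' r" if "r \<ge> 0" for r
    unfolding slope_def by (intro tendsto_intros avg that)
  have h': "h' s \<ge> 0" if "s \<ge> 0" for s
    using nonneg [OF that] le [OF that] order_trans by blast
  have cont_slope: "(\<lambda>s. s * slope N k h s) integrable_on {0..r}" if "continuous_on {0..} h" for h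
    by (intro integrable_continuous_real continuous_intros
        continuous_on_subset [OF continuous_on_slope [OF that]]) auto
  show ?thesis
    unfolding rsol_def
  proof (rule dominated_convergence(2))
    show "(\<lambda>s. s * slope N k (h n) s) integrable_on {0..r}" for n
      by (rule cont_slope [OF cont(1)])
    show "(\<lambda>s. s * slope N k h' s) integrable_on {0..r}"
      by (rule cont_slope [OF cont(2)])
    show "norm (s * slope N k (h n) s) \<le> s * slope N k h' s" if "s \<in> {0..r}" for n s
    proof -
      have "slope N k (h n) s \<ge> 0"
        using that by (intro slope_nonneg cont nonneg) auto
      moreover have "slope N k (h n) s \<le> slope N k h' s"
        using that by (intro slope_mono k cont le) auto
      ultimately show ?thesis using that by (simp add: mult_left_mono)
    qed
  qed (auto intro!: tendsto_mult slope)
qed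

lemma rsol_nonneg:
  assumes "continuous_on {0..} h" "\<And>s. s \<ge> 0 \<Longrightarrow> h s \<ge> 0"
  shows "rsol N k h r \<ge> 0"
  unfolding rsol_def
  by (intro integral_nonneg integrable_continuous_real continuous_intros
      continuous_on_subset [OF continuous_on_slope [OF assms(1)]] mult_nonneg_nonneg slope_nonneg assms) auto

lemma rsol_mono:
  assumes "1 \<le> k" "continuous_on {0..} h" "continuous_on {0..} h'" "\<And>s. s \<ge> 0 \<Longrightarrow> h s \<le> h' s"
  shows "rsol N k h r \<le> rsol N k h' r"
  unfolding rsol_def
  by (intro integral_le integrable_continuous_real continuous_intros
      continuous_on_subset [OF continuous_on_slope] assms mult_left_mono slope_mono) auto

lemma continuous_on_rsol:
  assumes "continuous_on {0..} h"
  shows "continuous_on {0..} (rsol N k h)"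
  unfolding rsol_def [abs_def]
  by (intro DERIV_continuous_on [where D = "\<lambda>s. s * slope N k h s"] integral_has_real_derivative_atLeast
      continuous_intros continuous_on_slope assms) auto

lemma rsol_has_derivative_at:
  assumes "continuous_on {0..} h" "r > 0"
  shows "(rsol N k h has_real_derivative r * slope N k h r) (at r)"
  unfolding rsol_def [abs_def]
  by (intro integral_has_real_derivative_at continuous_intros continuous_on_slope assms)

lemma rsol_mono_arg:
  assumes "continuous_on {0..} h" "\<And>s. s \<ge> 0 \<Longrightarrow> h s \<ge> 0" "r \<le> r'"
  shows "rsol N k h r \<le> rsol N k h r'"
  unfolding rsol_def
  by (intro integral_subset_le integrable_continuous_real continuous_intros
      continuous_on_subset [OF continuous_on_slope [OF assms(1)]])
     (use assms slope_nonneg [OF assms(1,2)] in auto)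

section \<open>Existence by monotone iteration\<close>

text \<open>The system prescribes the k-th root of \<open>S_k\<close>; the k-th power taken here is
  the value of \<open>S_k\<close> itself, the argument \<open>h\<close> of
  \<open>rsol\<close>.\<close>

definition source ::
  "nat \<Rightarrow> (real \<Rightarrow> real) \<Rightarrow> (real \<Rightarrow> real \<Rightarrow> real) \<Rightarrow> (real \<Rightarrow> real) \<Rightarrow> (real \<Rightarrow> real) \<Rightarrow> real \<Rightarrow> real" where
  "source k p f u v s = (p s * f (u s) (v s)) ^ k"

lemma continuous_on_source:
  assumes "continuous_on {0..} p" "nonlinearity f" "continuous_on {0..} u" "continuous_on {0..} v"
    and "\<And>s. s \<ge> 0 \<Longrightarrow> u s \<ge> 0" "\<And>s. s \<ge> 0 \<Longrightarrow> v s \<ge> 0"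
  shows "continuous_on {0..} (source k p f u v)"
  unfolding source_def [abs_def]
  by (intro continuous_on_power continuous_on_mult nonlinearity_continuous_on [OF assms(2)] assms(1,3,4))
     (use assms(5,6) in auto)

lemma source_mono:
  assumes "p s > 0" "nonlinearity f" "0 \<le> u s" "u s \<le> u' s" "0 \<le> v s" "v s \<le> v' s"
  shows "source k p f u v s \<le> source k p f u' v' s"
  unfolding source_def using assms nonlinearity_nonneg [OF assms(2)]
  by (intro power_mono mult_left_mono nonlinearity_mono [OF assms(2)]) auto

lemma le_root_if_power_le:
  assumes "n > 0" "x ^ n \<le> y" "x \<ge> 0"
  shows "x \<le> root n y"
  using real_root_le_mono [OF assms(1,2)] assms by (simp add: real_root_power_cancel)

section \<open>A priori bounds for subsolutions of the integral system\<close>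

context
  fixes N k :: nat and p q :: "real \<Rightarrow> real" and f g :: "real \<Rightarrow> real \<Rightarrow> real"
  assumes k: "1 \<le> k" "k \<le> N"
    and p: "continuous_on {0..} p" "\<And>r. r \<ge> 0 \<Longrightarrow> p r > 0"
    and q: "continuous_on {0..} q" "\<And>r. r \<ge> 0 \<Longrightarrow> q r > 0"
    and f: "nonlinearity f" and g: "nonlinearity g"
begin

lemma source_le_diag:
  assumes "s \<ge> 0" "u s \<ge> 0" "v s \<ge> 0"
  shows "source k p f u v s \<le> (p s ^ k + q s ^ k) * diag k f g (u s + v s)"
    and "source k q g u v s \<le> (p s ^ k + q s ^ k) * diag k f g (u s + v s)"
proof -
  note d = diag_ge [OF f g assms(2,3), of k]
  have "p s ^ k * f (u s) (v s) ^ k \<le> (p s ^ k + q s ^ k) * diag k f g (u s + v s)"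
    using assms p(2) [of s] q(2) [of s] nonlinearity_nonneg [OF f]
    by (intro mult_mono d) (auto intro!: add_nonneg_nonneg)
  then show "source k p f u v s \<le> (p s ^ k + q s ^ k) * diag k f g (u s + v s)"
    by (simp add: source_def power_mult_distrib)
  have "q s ^ k * g (u s) (v s) ^ k \<le> (p s ^ k + q s ^ k) * diag k f g (u s + v s)"
    using assms p(2) [of s] q(2) [of s] nonlinearity_nonneg [OF g]
    by (intro mult_mono d) (auto intro!: add_nonneg_nonneg)
  then show "source k q g u v s \<le> (p s ^ k + q s ^ k) * diag k f g (u s + v s)"
    by (simp add: source_def power_mult_distrib)
qed

lemma source_pos:
  assumes "s \<ge> 0" "u s > 0" "v s > 0"
  shows "source k p f u v s > 0" "source k q g u v s > 0"
  using assms p(2) q(2) nonlinearity_pos [OF f] nonlinearity_pos [OF g]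
  by (auto simp: source_def)

text \<open>Stated for subsolutions because an iterate lies below its successor without solving the
  system. \<open>T\<close> and \<open>L\<close> are fixed before \<open>u\<close> and
  \<open>v\<close>, hence uniform along the iteration.\<close>

lemma subsolution_bound:
  assumes KO: "keller_osserman_integral k f g = \<infinity>" and "R \<ge> 0"
  obtains T L where
    "\<And>u v r. \<lbrakk>continuous_on {0..} u; continuous_on {0..} v;
       \<And>s. s \<ge> 0 \<Longrightarrow> 1 \<le> u s \<and> u s \<le> 1 + rsol N k (source k p f u v) s;
       \<And>s. s \<ge> 0 \<Longrightarrow> 1 \<le> v s \<and> v s \<le> 1 + rsol N k (source k q g u v) s; 0 \<le> r; r \<le> R\<rbrakk> \<Longrightarrow>
       2 + rsol N k (source k p f u v) r + rsol N k (source k q g u v) r \<le> T \<and>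
       r * slope N k (source k p f u v) r \<le> L \<and> r * slope N k (source k q g u v) r \<le> L"
proof -
  let ?C = "real ((N - 1) choose (k - 1))" and ?G = "KO_root k f g"
  have C: "?C > 0" using binom_pred_pos [OF k] .
  have "continuous_on {0..R} (\<lambda>s. p s ^ k + q s ^ k)"
    by (intro continuous_intros continuous_on_subset [OF p(1)] continuous_on_subset [OF q(1)]) auto
  then obtain s0 where "s0 \<in> {0..R}" and s0: "\<And>s. s \<in> {0..R} \<Longrightarrow> p s ^ k + q s ^ k \<le> p s0 ^ k + q s0 ^ k"
    using continuous_attains_sup [of "{0..R}" "\<lambda>s. p s ^ k + q s ^ k"] \<open>R \<ge> 0\<close> by auto
  define P where "P = p s0 ^ k + q s0 ^ k"
  have P: "P \<ge> 0" using \<open>s0 \<in> {0..R}\<close> p(2) [of s0] q(2) [of s0] by (simp add: P_def)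
  \<comment> \<open>The constant for \<open>growth_estimate\<close> with \<open>\<omega> = 1\<close>
    on \<open>[0, R]\<close>: there \<open>s^(k-1) \<le> R^(k-1)\<close> and the sum of the weights
    is at most \<open>P\<close>.\<close>
  define B where "B = R ^ (k - 1) * P / ?C"
  have B: "B \<ge> 0" using P C \<open>R \<ge> 0\<close> by (simp add: B_def)
  define c where "c = root (k + 1) B"
  have c: "c \<ge> 0" using B by (simp add: c_def)
  have Gpos: "?G t > 0" if "t \<ge> 1" for t
    using KO_root_pos [OF f g] that by simp
  \<comment> \<open>The upper limit 2 is the value of \<open>W\<close> at 0, and
    \<open>2 c R\<close> is the growth of \<open>\<Theta>\<close> up to \<open>R\<close>: each of
    the two components has derivative at most \<open>c G(W)\<close>.\<close>
  obtain T where T: "integral {1..T} (\<lambda>t. 1 / ?G t) > integral {1..2} (\<lambda>t. 1 / ?G t) + 2 * c * R"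
    using KO_integral_unbounded [OF f g KO] .
  show thesis
  proof (rule that [of T "c * ?G T"])
    fix u v r
    assume cont: "continuous_on {0..} u" "continuous_on {0..} v"
      and u: "\<And>s. s \<ge> 0 \<Longrightarrow> 1 \<le> u s \<and> u s \<le> 1 + rsol N k (source k p f u v) s"
      and v: "\<And>s. s \<ge> 0 \<Longrightarrow> 1 \<le> v s \<and> v s \<le> 1 + rsol N k (source k q g u v) s"
      and r: "0 \<le> r" "r \<le> R"
    let ?h = "source k p f u v" and ?j = "source k q g u v"
    define u' where "u' s = 1 + rsol N k ?h s" for s
    define v' where "v' s = 1 + rsol N k ?j s" for s
    \<comment> \<open>\<open>W\<close> is built from the images of \<open>u\<close> and
      \<open>v\<close>, whose derivatives are known, and not from \<open>u + v\<close>. As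
      \<open>u \<le> u'\<close> and \<open>v \<le> v'\<close>, the sources are still bounded in
      terms of \<open>W\<close>.\<close>
    define W where "W s = 2 + rsol N k ?h s + rsol N k ?j s" for s
    have W_eq: "W s = u' s + v' s" for s by (simp add: W_def u'_def v'_def)
    have nonneg: "u s \<ge> 0" "v s \<ge> 0" if "s \<ge> 0" for s
      using u [OF that] v [OF that] by auto
    have pos: "u s > 0" "v s > 0" if "s \<ge> 0" for s
      using u [OF that] v [OF that] by auto
    have hcont: "continuous_on {0..} ?h" "continuous_on {0..} ?j"
      by (intro continuous_on_source p q f g cont nonneg; assumption)+
    have hpos: "?h s > 0" "?j s > 0" if "s \<ge> 0" for s
      using source_pos [of s u v] that pos by auto
    have W2: "W s \<ge> 2" for s
      using rsol_nonneg [OF hcont(1) less_imp_le [OF hpos(1)]] rsol_nonneg [OF hcont(2) less_imp_le [OF hpos(2)]]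
      by (simp add: W_def add_nonneg_nonneg)
    have Wcont: "continuous_on {0..} W"
      unfolding W_def [abs_def] by (intro continuous_intros continuous_on_rsol hcont)
    have dW: "(W has_real_derivative s * slope N k ?h s + s * slope N k ?j s) (at s)" if "s > 0" for s
      unfolding W_def [abs_def] using rsol_has_derivative_at [OF hcont(1) that] rsol_has_derivative_at [OF hcont(2) that]
      by (auto intro!: derivative_eq_intros)
    have snn: "s * slope N k ?h s \<ge> 0" "s * slope N k ?j s \<ge> 0" if "s \<ge> 0" for s
      using mult_nonneg_nonneg [OF that slope_nonneg [OF hcont(1) less_imp_le [OF hpos(1)] that]]
        mult_nonneg_nonneg [OF that slope_nonneg [OF hcont(2) less_imp_le [OF hpos(2)] that]] by auto
    have hle: "1 / ?C * 1 ^ (k + 1) * s ^ (k - 1) * h s \<le> B * diag k f g (W s)"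
      if "h \<in> {?h, ?j}" "s \<ge> 0" "s \<le> R" for h s
    proof -
      have "h s \<le> (p s ^ k + q s ^ k) * diag k f g (W s)"
      proof -
        have "?h s \<le> source k p f u' v' s" "?j s \<le> source k q g u' v' s"
          using u [OF that(2)] v [OF that(2)] p(2) [OF that(2)] q(2) [OF that(2)] f g
          by (auto intro!: source_mono simp: u'_def v'_def)
        moreover have "source k p f u' v' s \<le> (p s ^ k + q s ^ k) * diag k f g (W s)"
          "source k q g u' v' s \<le> (p s ^ k + q s ^ k) * diag k f g (W s)"
          using source_le_diag [of s u' v'] u [OF that(2)] v [OF that(2)] that(2)
          unfolding W_eq u'_def v'_def by auto
        ultimately show ?thesis using that(1) by auto
      qed
      also have "\<dots> \<le> P * diag k f g (W s)"
        using s0 [of s] that W2 [of s] by (intro mult_right_mono diag_nonneg [OF f g]) (auto simp: P_def)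
      finally have "s ^ (k - 1) * h s \<le> R ^ (k - 1) * (P * diag k f g (W s))"
        using that hpos [of s] by (intro mult_mono power_mono) auto
      then show ?thesis using C by (simp add: B_def divide_right_mono mult.assoc)
    qed
    have est: "s * slope N k h s \<le> c * ?G (W s)" if "h \<in> {?h, ?j}" "s \<ge> 0" "s \<le> R" for h s
    proof -
      have "(1 * (s * slope N k h s)) ^ (k + 1) \<le>
           (1 * (0 * slope N k h 0)) ^ (k + 1) + B * (real (k + 1) * primitive_F k f g (W s))"
      proof (rule growth_estimate [where \<omega> = "\<lambda>_. 1" and \<omega>' = "\<lambda>_. 0", OF f g k])
        show "continuous_on {0..s} W"
          using Wcont by (rule continuous_on_subset) auto
        show "(W has_real_derivative r * slope N k ?h r + r * slope N k ?j r) (at r)" if "r \<in> {0<..<s}" for r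
          using dW that by simp
        show "r * slope N k h r \<le> r * slope N k ?h r + r * slope N k ?j r" if "r \<in> {0<..<s}" for r
          using snn [of r] that \<open>h \<in> {?h, ?j}\<close> by auto
        show "1 / ?C * 1 ^ (k + 1) * r ^ (k - 1) * h r \<le> B * diag k f g (W r)" if "r \<in> {0<..<s}" for r
          using hle [OF \<open>h \<in> {?h, ?j}\<close>, of r] that \<open>s \<le> R\<close> by simp
        show "0 < W r" for r using W2 [of r] by simp
        show "0 < h s" if "0 \<le> s" for s
          using hpos [OF that] \<open>h \<in> {?h, ?j}\<close> by auto
        show "continuous_on {0..} h" using hcont \<open>h \<in> {?h, ?j}\<close> by auto
        show "r * 0 \<le> (real N / real k - 1) * 1" for r :: real
          using k by (simp add: field_simps)
      qed (use that B in auto)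
      then have "(s * slope N k h s) ^ (k + 1) \<le> B * (real (k + 1) * primitive_F k f g (W s))"
        by simp
      then have "s * slope N k h s \<le> root (k + 1) (B * (real (k + 1) * primitive_F k f g (W s)))"
        using snn [OF that(2)] that(1) by (intro le_root_if_power_le) auto
      then show ?thesis by (simp only: real_root_mult c_def KO_root_def [OF f g])
    qed
    have WT: "W s \<le> T" if "s \<ge> 0" "s \<le> R" for s
    proof (rule osgood_bound [where \<Theta> = "\<lambda>r. 2 * c * r" and \<theta> = "\<lambda>_. 2 * c",
          OF continuous_on_KO_root [OF f g] Gpos that(1)])
      show "continuous_on {0..s} W"
        using Wcont by (rule continuous_on_subset) auto
      show "1 < W r" for r using W2 [of r] by simp
      show "(W has_real_derivative r * slope N k ?h r + r * slope N k ?j r) (at r)" if "r \<in> {0<..<s}" for r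
        using dW that by simp
      show "r * slope N k ?h r + r * slope N k ?j r \<le> 2 * c * ?G (W r)" if "r \<in> {0<..<s}" for r
        using est [of ?h r] est [of ?j r] that \<open>s \<le> R\<close> by simp
      have "W 0 = 2" by (simp add: W_def rsol_def)
      then show "integral {1..W 0} (\<lambda>t. 1 / ?G t) + 2 * c * s - 2 * c * 0 < integral {1..T} (\<lambda>t. 1 / ?G t)"
        using mult_left_mono [OF that(2) c] T by simp
    qed (auto intro!: continuous_intros derivative_eq_intros)
    have "?G (W r) \<le> ?G T"
      unfolding KO_root_def [OF f g] using WT [OF r]
      by (intro real_root_le_mono mult_left_mono F_mono [OF f g]) auto
    then have "c * ?G (W r) \<le> c * ?G T"
      using c by (rule mult_left_mono)
    then show "2 + rsol N k ?h r + rsol N k ?j r \<le> T \<and> r * slope N k ?h r \<le> c * ?G T \<and> r * slope N k ?j r \<le> c * ?G T"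
      using WT [OF r] est [of ?h r] est [of ?j r] r unfolding W_def by auto
  qed
qed

end

text \<open>The local Lipschitz constant does not depend on \<open>n\<close>, so it passes to the
  pointwise limit and makes it continuous. Monotonicity in \<open>r\<close> supplies the lower half
  of the estimate for differences.\<close>

lemma increasing_lipschitz_limit:
  fixes w :: "nat \<Rightarrow> real \<Rightarrow> real"
  assumes inc: "\<And>n r. r \<ge> 0 \<Longrightarrow> w n r \<le> w (Suc n) r"
    and mono: "\<And>n s r. 0 \<le> s \<Longrightarrow> s \<le> r \<Longrightarrow> w n s \<le> w n r"
    and bound: "\<And>R. R \<ge> 0 \<Longrightarrow> \<exists>T. \<forall>n. \<forall>r\<in>{0..R}. w n r \<le> T"
    and lip: "\<And>R. R \<ge> 0 \<Longrightarrow> \<exists>L. \<forall>n. \<forall>r\<in>{0..R}. \<forall>s\<in>{0..r}. w n r - w n s \<le> L * (r - s)"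
  obtains U where "continuous_on {0..} U" "\<And>r. r \<ge> 0 \<Longrightarrow> (\<lambda>n. w n r) \<longlonglongrightarrow> U r"
    "\<And>n r. r \<ge> 0 \<Longrightarrow> w n r \<le> U r"
proof -
  have "\<exists>l. (\<lambda>n. w n r) \<longlonglongrightarrow> l \<and> (\<forall>n. w n r \<le> l)" if r: "r \<ge> 0" for r
  proof -
    have "incseq (\<lambda>n. w n r)"
      using inc [OF r] by (rule incseq_SucI)
    moreover obtain T where "\<forall>n. w n r \<le> T"
      using bound [OF r] r by (meson atLeastAtMost_iff order_refl)
    ultimately show ?thesis
      by (metis incseq_convergent incseq_le)
  qed
  then obtain U where lim: "\<And>r. r \<ge> 0 \<Longrightarrow> (\<lambda>n. w n r) \<longlonglongrightarrow> U r" and le: "\<And>r n. r \<ge> 0 \<Longrightarrow> w n r \<le> U r"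
    by metis
  have Umono: "U s \<le> U r" if "0 \<le> s" "s \<le> r" for s r
    using lim [of s] lim [of r] mono [OF that] that
    by (intro LIMSEQ_le [of "\<lambda>n. w n s" _ "\<lambda>n. w n r"]) auto
  have "continuous (at x within {0..}) U" if x: "x \<ge> 0" for x
  proof -
    have "0 \<le> x + 1" using x by simp
    from lip [OF this] obtain L
      where L: "\<forall>n. \<forall>r\<in>{0..x + 1}. \<forall>s\<in>{0..r}. w n r - w n s \<le> L * (r - s)" ..
    have UL: "U r - U s \<le> L * (r - s)" if "0 \<le> s" "s \<le> r" "r \<le> x + 1" for r s
    proof (rule LIMSEQ_le_const2)
      show "(\<lambda>n. w n r - w n s) \<longlonglongrightarrow> U r - U s"
        using that by (intro tendsto_diff lim) auto
    qed (use L that in auto)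
    have "norm (U y - U x) \<le> L * \<bar>y - x\<bar>" if "0 \<le> y" "y \<le> x + 1" for y
      using UL [of x y] UL [of y x] Umono [of x y] Umono [of y x] that x
      by (cases "x \<le> y") (auto simp: abs_if)
    moreover have "\<forall>\<^sub>F y in at x within {0..}. 0 \<le> y \<and> y \<le> x + 1"
    proof -
      have "\<forall>\<^sub>F y in at x within {0..}. y \<in> {..<x + 1}"
        by (rule topological_tendstoD [OF tendsto_ident_at]) auto
      moreover have "\<forall>\<^sub>F y in at x within {0..}. y \<in> {0..}"
        by (simp add: eventually_at_filter)
      ultimately show ?thesis by eventually_elim auto
    qed
    ultimately have "\<forall>\<^sub>F y in at x within {0..}. norm (U y - U x) \<le> L * \<bar>y - x\<bar>"
      by (auto elim: eventually_mono)
    moreover have "((\<lambda>y. L * \<bar>y - x\<bar>) \<longlongrightarrow> 0) (at x within {0..})"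
      by (auto intro!: tendsto_eq_intros)
    ultimately have "((\<lambda>y. U y - U x) \<longlongrightarrow> 0) (at x within {0..})"
      by (rule Lim_null_comparison)
    then show ?thesis
      unfolding continuous_within by (rule LIM_zero_cancel)
  qed
  then have "continuous_on {0..} U"
    by (simp add: continuous_on_eq_continuous_within)
  then show thesis using lim le by (rule that)
qed

section \<open>Convergence of the iteration and the resulting entire solution\<close>

context
  fixes N k :: nat and p q :: "real \<Rightarrow> real" and f g :: "real \<Rightarrow> real \<Rightarrow> real"
  assumes k: "1 \<le> k" "k \<le> N"
    and p: "continuous_on {0..} p" "\<And>r. r \<ge> 0 \<Longrightarrow> p r > 0"
    and q: "continuous_on {0..} q" "\<And>r. r \<ge> 0 \<Longrightarrow> q r > 0"
    and f: "nonlinearity f" and g: "nonlinearity g"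
begin

lemma source_tendsto:
  assumes "nonlinearity f'" "(\<lambda>n. u n s) \<longlonglongrightarrow> U s" "(\<lambda>n. v n s) \<longlonglongrightarrow> V s"
    and "\<And>n. u n s \<ge> 0" "\<And>n. v n s \<ge> 0" "U s \<ge> 0" "V s \<ge> 0"
  shows "(\<lambda>n. source k p' f' (u n) (v n) s) \<longlonglongrightarrow> source k p' f' U V s"
proof -
  have "continuous_on ({0..} \<times> {0..}) (\<lambda>(s, t). f' s t)"
    using assms(1) by (simp add: nonlinearity_def)
  from continuous_on_tendsto_compose [OF this tendsto_Pair [OF assms(2,3)]] assms(4-)
  have "(\<lambda>n. f' (u n s) (v n s)) \<longlonglongrightarrow> f' (U s) (V s)" by simp
  then show ?thesis unfolding source_def by (intro tendsto_intros)
qed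

text \<open>Monotonicity of the sources makes the iterates increase in \<open>n\<close>; the uniform
  bounds then give continuous limits, and the equations pass to the limit by
  \<open>rsol_tendsto\<close>.\<close>

lemma integral_system_solution:
  assumes KO: "keller_osserman_integral k f g = \<infinity>"
  obtains U V where "continuous_on {0..} U" "continuous_on {0..} V"
    "\<And>r. r \<ge> 0 \<Longrightarrow> U r \<ge> 1" "\<And>r. r \<ge> 0 \<Longrightarrow> V r \<ge> 1"
    "\<And>r. r \<ge> 0 \<Longrightarrow> U r = 1 + rsol N k (source k p f U V) r"
    "\<And>r. r \<ge> 0 \<Longrightarrow> V r = 1 + rsol N k (source k q g U V) r"
proof -
  \<comment> \<open>Both components are updated simultaneously, starting from the pair of constants
    1.\<close>
  define it where "it n = ((\<lambda>(u, v). (\<lambda>r. 1 + rsol N k (source k p f u v) r,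
      \<lambda>r. 1 + rsol N k (source k q g u v) r)) ^^ n) (\<lambda>_. 1, \<lambda>_. 1)" for n :: nat
  define u where "u n = fst (it n)" for n
  define v where "v n = snd (it n)" for n
  have it0: "u 0 = (\<lambda>_. 1)" "v 0 = (\<lambda>_. 1)"
    by (simp_all add: u_def v_def it_def)
  have itS: "u (Suc n) = (\<lambda>r. 1 + rsol N k (source k p f (u n) (v n)) r)"
    "v (Suc n) = (\<lambda>r. 1 + rsol N k (source k q g (u n) (v n)) r)" for n
    by (simp_all add: u_def v_def it_def split_beta)
  have base: "continuous_on {0..} (u n) \<and> continuous_on {0..} (v n) \<and> (\<forall>s\<ge>0. 1 \<le> u n s \<and> 1 \<le> v n s)" for n
  proof (induction n)
    case (Suc n)
    then have cont: "continuous_on {0..} (u n)" "continuous_on {0..} (v n)"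
      and ge: "\<And>s. s \<ge> 0 \<Longrightarrow> 1 \<le> u n s" "\<And>s. s \<ge> 0 \<Longrightarrow> 1 \<le> v n s" by auto
    have nn: "\<And>s. s \<ge> 0 \<Longrightarrow> 0 \<le> u n s" "\<And>s. s \<ge> 0 \<Longrightarrow> 0 \<le> v n s"
      using ge by (meson order_trans zero_le_one)+
    have c: "continuous_on {0..} (source k p f (u n) (v n))" "continuous_on {0..} (source k q g (u n) (v n))"
      by (rule continuous_on_source [OF p(1) f cont nn] continuous_on_source [OF q(1) g cont nn]; assumption)+
    have pos: "source k p f (u n) (v n) s \<ge> 0" "source k q g (u n) (v n) s \<ge> 0" if "s \<ge> 0" for s
      using source_pos [OF k p q f g that, of "u n" "v n"] ge [OF that] by auto
    show ?case
      using rsol_nonneg [OF c(1) pos(1), where N = N and k = k] rsol_nonneg [OF c(2) pos(2), where N = N and k = k]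
      unfolding itS by (auto intro!: continuous_on_add continuous_on_rsol c)
  qed (simp add: it0)
  then have cont: "continuous_on {0..} (u n)" "continuous_on {0..} (v n)"
    and ge: "s \<ge> 0 \<Longrightarrow> 1 \<le> u n s" "s \<ge> 0 \<Longrightarrow> 1 \<le> v n s" for n s by auto
  have nn: "s \<ge> 0 \<Longrightarrow> 0 \<le> u n s" "s \<ge> 0 \<Longrightarrow> 0 \<le> v n s" for n s
    using ge by (meson order_trans zero_le_one)+
  have c: "continuous_on {0..} (source k p f (u n) (v n))" "continuous_on {0..} (source k q g (u n) (v n))" for n
    by (rule continuous_on_source [OF p(1) f cont nn] continuous_on_source [OF q(1) g cont nn]; assumption)+
  have pos: "source k p f (u n) (v n) s > 0" "source k q g (u n) (v n) s > 0" if "s \<ge> 0" for s n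
    using source_pos [OF k p q f g that, of "u n" "v n"] ge [OF that, of n] by auto
  note nonneg = less_imp_le [OF pos(1)] less_imp_le [OF pos(2)]
  have inc: "\<forall>s\<ge>0. u n s \<le> u (Suc n) s \<and> v n s \<le> v (Suc n) s" for n
  proof (induction n)
    case 0
    then show ?case using ge [where n = "Suc 0"] by (simp add: it0)
  next
    case (Suc n)
    have s: "source k p f (u n) (v n) s \<le> source k p f (u (Suc n)) (v (Suc n)) s"
      "source k q g (u n) (v n) s \<le> source k q g (u (Suc n)) (v (Suc n)) s" if "s \<ge> 0" for s
      using Suc that nn [OF that] p(2) [OF that] q(2) [OF that] f g by (auto intro!: source_mono)
    have "u (Suc n) s \<le> u (Suc (Suc n)) s" for s
      using rsol_mono [OF k(1) c(1) c(1) s(1), of N s]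
        fun_cong [OF itS(1) [of n], of s] fun_cong [OF itS(1) [of "Suc n"], of s] by simp
    moreover have "v (Suc n) s \<le> v (Suc (Suc n)) s" for s
      using rsol_mono [OF k(1) c(2) c(2) s(2), of N s]
        fun_cong [OF itS(2) [of n], of s] fun_cong [OF itS(2) [of "Suc n"], of s] by simp
    ultimately show ?case by blast
  qed
  \<comment> \<open>The monotonicity \<open>inc\<close> says that each iterate is a subsolution, so
    \<open>subsolution_bound\<close> applies to all of them with the same constants.\<close>
  have bd: "\<exists>T L. \<forall>n. \<forall>r\<in>{0..R}. u (Suc n) r + v (Suc n) r \<le> T \<and>
      r * slope N k (source k p f (u n) (v n)) r \<le> L \<and> r * slope N k (source k q g (u n) (v n)) r \<le> L"
    if R: "R \<ge> 0" for R
  proof -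
    obtain T L where
      TL: "\<And>u v r. \<lbrakk>continuous_on {0..} u; continuous_on {0..} v;
       \<And>s. s \<ge> 0 \<Longrightarrow> 1 \<le> u s \<and> u s \<le> 1 + rsol N k (source k p f u v) s;
       \<And>s. s \<ge> 0 \<Longrightarrow> 1 \<le> v s \<and> v s \<le> 1 + rsol N k (source k q g u v) s; 0 \<le> r; r \<le> R\<rbrakk> \<Longrightarrow>
       2 + rsol N k (source k p f u v) r + rsol N k (source k q g u v) r \<le> T \<and>
       r * slope N k (source k p f u v) r \<le> L \<and> r * slope N k (source k q g u v) r \<le> L"
      using subsolution_bound [OF k p q f g KO R] by blast
    have "u (Suc n) r + v (Suc n) r \<le> T \<and>
      r * slope N k (source k p f (u n) (v n)) r \<le> L \<and> r * slope N k (source k q g (u n) (v n)) r \<le> L"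
      if "r \<in> {0..R}" for n r
    proof -
      have "1 \<le> u n s \<and> u n s \<le> 1 + rsol N k (source k p f (u n) (v n)) s"
        "1 \<le> v n s \<and> v n s \<le> 1 + rsol N k (source k q g (u n) (v n)) s" if "s \<ge> 0" for s
        using inc [of n] ge [OF that] that unfolding itS by auto
      from TL [OF cont this, of r] that show ?thesis
        by (simp add: itS)
    qed
    then show ?thesis by blast
  qed
  \<comment> \<open>The derivative of \<open>rsol\<close> is \<open>r * slope\<close>; a bound
    \<open>L\<close> for it makes \<open>L r - rsol\<close> nondecreasing.\<close>
  have lip: "rsol N k h r - rsol N k h s \<le> L * (r - s)"
    if h: "continuous_on {0..} h" and s: "0 \<le> s" "s \<le> r" and L: "\<And>t. 0 \<le> t \<Longrightarrow> t \<le> r \<Longrightarrow> t * slope N k h t \<le> L"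
    for h r s L
  proof -
    have "L * s - rsol N k h s \<le> L * r - rsol N k h r"
    proof (rule DERIV_nonneg_imp_increasing_open [OF s(2)])
      fix t assume t: "s < t" "t < r"
      then have "((\<lambda>r. L * r - rsol N k h r) has_real_derivative L - t * slope N k h t) (at t)"
        using rsol_has_derivative_at [OF h, of t] s by (auto intro!: derivative_eq_intros)
      moreover have "L - t * slope N k h t \<ge> 0" using L t s by simp
      ultimately show "\<exists>y. ((\<lambda>r. L * r - rsol N k h r) has_real_derivative y) (at t) \<and> 0 \<le> y" by blast
    next
      show "continuous_on {s..r} (\<lambda>r. L * r - rsol N k h r)"
        using s by (intro continuous_intros continuous_on_subset [OF continuous_on_rsol [OF h]]) auto
    qed
    then show ?thesis by (simp add: algebra_simps)
  qed
  \<comment> \<open>The sequence is shifted because the formula \<open>itS\<close> and the bounds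
    \<open>bd\<close> concern \<open>u (Suc n)\<close>; \<open>LIMSEQ_imp_Suc\<close> removes the
    shift later.\<close>
  obtain U where U: "continuous_on {0..} U" "\<And>r. r \<ge> 0 \<Longrightarrow> (\<lambda>n. u (Suc n) r) \<longlonglongrightarrow> U r"
    "\<And>n r. r \<ge> 0 \<Longrightarrow> u (Suc n) r \<le> U r"
  proof (rule increasing_lipschitz_limit [of "\<lambda>n. u (Suc n)"])
    show "u (Suc n) r \<le> u (Suc (Suc n)) r" if "r \<ge> 0" for n r
      using inc [of "Suc n"] that by blast
    show "u (Suc n) s \<le> u (Suc n) r" if "0 \<le> s" "s \<le> r" for n s r
      unfolding itS using rsol_mono_arg [OF c(1) nonneg(1) that(2)] by simp
  next
    fix R :: real assume R: "R \<ge> 0"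
    obtain T L where TL: "\<forall>n. \<forall>r\<in>{0..R}. u (Suc n) r + v (Suc n) r \<le> T \<and>
      r * slope N k (source k p f (u n) (v n)) r \<le> L \<and> r * slope N k (source k q g (u n) (v n)) r \<le> L"
      using bd [OF R] by blast
    have "u (Suc n) r \<le> T" if "r \<in> {0..R}" for n r
      using bspec [OF spec [OF TL, of n] that] nn(2) [of r "Suc n"] that by auto
    then show "\<exists>T. \<forall>n. \<forall>r\<in>{0..R}. u (Suc n) r \<le> T" by blast
    have "u (Suc n) r - u (Suc n) s \<le> L * (r - s)" if "r \<in> {0..R}" "s \<in> {0..r}" for n r s
      using lip [OF c(1) [of n], of s r L] that TL unfolding itS by auto
    then show "\<exists>L. \<forall>n. \<forall>r\<in>{0..R}. \<forall>s\<in>{0..r}. u (Suc n) r - u (Suc n) s \<le> L * (r - s)" by blast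
  qed (rule that)
  obtain V where V: "continuous_on {0..} V" "\<And>r. r \<ge> 0 \<Longrightarrow> (\<lambda>n. v (Suc n) r) \<longlonglongrightarrow> V r"
    "\<And>n r. r \<ge> 0 \<Longrightarrow> v (Suc n) r \<le> V r"
  proof (rule increasing_lipschitz_limit [of "\<lambda>n. v (Suc n)"])
    show "v (Suc n) r \<le> v (Suc (Suc n)) r" if "r \<ge> 0" for n r
      using inc [of "Suc n"] that by blast
    show "v (Suc n) s \<le> v (Suc n) r" if "0 \<le> s" "s \<le> r" for n s r
      unfolding itS using rsol_mono_arg [OF c(2) nonneg(2) that(2)] by simp
  next
    fix R :: real assume R: "R \<ge> 0"
    obtain T L where TL: "\<forall>n. \<forall>r\<in>{0..R}. u (Suc n) r + v (Suc n) r \<le> T \<and>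
      r * slope N k (source k p f (u n) (v n)) r \<le> L \<and> r * slope N k (source k q g (u n) (v n)) r \<le> L"
      using bd [OF R] by blast
    have "v (Suc n) r \<le> T" if "r \<in> {0..R}" for n r
      using bspec [OF spec [OF TL, of n] that] nn(1) [of r "Suc n"] that by auto
    then show "\<exists>T. \<forall>n. \<forall>r\<in>{0..R}. v (Suc n) r \<le> T" by blast
    have "v (Suc n) r - v (Suc n) s \<le> L * (r - s)" if "r \<in> {0..R}" "s \<in> {0..r}" for n r s
      using lip [OF c(2) [of n], of s r L] that TL unfolding itS by auto
    then show "\<exists>L. \<forall>n. \<forall>r\<in>{0..R}. \<forall>s\<in>{0..r}. v (Suc n) r - v (Suc n) s \<le> L * (r - s)" by blast
  qed (rule that)
  have lim: "(\<lambda>n. u n r) \<longlonglongrightarrow> U r" "(\<lambda>n. v n r) \<longlonglongrightarrow> V r" if "r \<ge> 0" for r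
    using LIMSEQ_imp_Suc [OF U(2) [OF that]] LIMSEQ_imp_Suc [OF V(2) [OF that]] .
  have le: "u n r \<le> U r" "v n r \<le> V r" if "r \<ge> 0" for n r
    using inc [of n] U(3) [OF that, of n] V(3) [OF that, of n] that by force+
  have UV1: "U r \<ge> 1" "V r \<ge> 1" if "r \<ge> 0" for r
    using le [OF that, of 0] by (simp_all add: it0)
  have UV0: "U r \<ge> 0" "V r \<ge> 0" if "r \<ge> 0" for r
    using UV1 [OF that] by auto
  have C: "continuous_on {0..} (source k p f U V)" "continuous_on {0..} (source k q g U V)"
    by (rule continuous_on_source [OF p(1) f U(1) V(1) UV0] continuous_on_source [OF q(1) g U(1) V(1) UV0]; assumption)+
  have "U r = 1 + rsol N k (source k p f U V) r" if r: "r \<ge> 0" for r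
  proof -
    have "(\<lambda>n. rsol N k (source k p f (u n) (v n)) r) \<longlonglongrightarrow> rsol N k (source k p f U V) r"
    proof (rule rsol_tendsto [OF k c(1) C(1) nonneg(1) _ _ r])
      show "source k p f (u n) (v n) s \<le> source k p f U V s" if "s \<ge> 0" for n s
        using that le nn p(2) f by (intro source_mono) auto
      show "(\<lambda>n. source k p f (u n) (v n) s) \<longlonglongrightarrow> source k p f U V s" if "s \<ge> 0" for s
        using that lim nn UV0 by (intro source_tendsto [OF f]) auto
    qed
    then have "(\<lambda>n. u (Suc n) r) \<longlonglongrightarrow> 1 + rsol N k (source k p f U V) r"
      unfolding itS by (intro tendsto_intros)
    from LIMSEQ_unique [OF U(2) [OF r] this] show ?thesis .
  qed
  moreover have "V r = 1 + rsol N k (source k q g U V) r" if r: "r \<ge> 0" for r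
  proof -
    have "(\<lambda>n. rsol N k (source k q g (u n) (v n)) r) \<longlonglongrightarrow> rsol N k (source k q g U V) r"
    proof (rule rsol_tendsto [OF k c(2) C(2) nonneg(2) _ _ r])
      show "source k q g (u n) (v n) s \<le> source k q g U V s" if "s \<ge> 0" for n s
        using that le nn q(2) g by (intro source_mono) auto
      show "(\<lambda>n. source k q g (u n) (v n) s) \<longlonglongrightarrow> source k q g U V s" if "s \<ge> 0" for s
        using that lim nn UV0 by (intro source_tendsto [OF g]) auto
    qed
    then have "(\<lambda>n. v (Suc n) r) \<longlonglongrightarrow> 1 + rsol N k (source k q g U V) r"
      unfolding itS by (intro tendsto_intros)
    from LIMSEQ_unique [OF V(2) [OF r] this] show ?thesis .
  qed
  ultimately show thesis
    using that [OF U(1) V(1) UV1] by blast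
qed

text \<open>The lower bound 1 for both profiles serves twice: it makes the sources positive, as
  \<open>rsol_admissible\<close> requires, and it gives nontriviality.\<close>

lemma exists_solution:
  assumes N: "N = CARD('n::finite)" and KO: "keller_osserman_integral k f g = \<infinity>"
  shows "\<exists>(u :: real ^ 'n \<Rightarrow> real) v. nonneg_radial_solution k p q f g u v \<and> nontrivial u v"
proof -
  obtain U V where cont: "continuous_on {0..} U" "continuous_on {0..} V"
    and ge: "\<And>r. r \<ge> 0 \<Longrightarrow> U r \<ge> 1" "\<And>r. r \<ge> 0 \<Longrightarrow> V r \<ge> 1"
    and eq: "\<And>r. r \<ge> 0 \<Longrightarrow> U r = 1 + rsol N k (source k p f U V) r"
    "\<And>r. r \<ge> 0 \<Longrightarrow> V r = 1 + rsol N k (source k q g U V) r"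
    using integral_system_solution [OF KO] by blast
  have nn: "U r \<ge> 0" "V r \<ge> 0" if "r \<ge> 0" for r
    using ge [OF that] by auto
  have C: "continuous_on {0..} (source k p f U V)" "continuous_on {0..} (source k q g U V)"
    by (rule continuous_on_source [OF p(1) f cont nn] continuous_on_source [OF q(1) g cont nn]; assumption)+
  have pos: "source k p f U V s > 0" "source k q g U V s > 0" if "s \<ge> 0" for s
    using source_pos [OF k p q f g that, of U V] ge [OF that] by auto
  let ?u = "\<lambda>x :: real ^ 'n. 1 + rsol N k (source k p f U V) (norm x)"
  let ?v = "\<lambda>x :: real ^ 'n. 1 + rsol N k (source k q g U V) (norm x)"
  have uv: "?u x = U (norm x)" "?v x = V (norm x)" for x
    using eq [of "norm x"] by auto
  note Au = rsol_admissible [where c = 1, OF k C(1) pos(1) N] and Av = rsol_admissible [where c = 1, OF k C(2) pos(2) N]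
  have root: "root k (source k p f U V r) = p r * f (U r) (V r)" "root k (source k q g U V r) = q r * g (U r) (V r)"
    if "r \<ge> 0" for r
    using k p(2) [OF that] q(2) [OF that] nonlinearity_nonneg [OF f nn [OF that]] nonlinearity_nonneg [OF g nn [OF that]]
    by (simp_all add: source_def real_root_power_cancel)
  have "elem_sym k (eigenvalue_vector (hessian ?u x)) = source k p f U V (norm x)"
    "elem_sym k (eigenvalue_vector (hessian ?v x)) = source k q g U V (norm x)" for x
    using Au Av by auto
  then have "hessian_system k p q f g ?u ?v"
    unfolding hessian_system_def uv by (simp add: root)
  moreover have "radial ?u" "radial ?v"
    by (simp_all add: radial_def)
  moreover have pos: "?u x > 0" "?v x > 0" for x
    unfolding uv using ge [of "norm x"] by auto
  ultimately have "nonneg_radial_solution k p q f g ?u ?v"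
    using Au(1) Av(1) unfolding nonneg_radial_solution_def by (simp add: less_imp_le)
  moreover have "nontrivial ?u ?v"
    using pos(1) [of 0] unfolding nontrivial_def by (metis less_irrefl)
  ultimately show ?thesis by blast
qed

end

section \<open>Large solutions\<close>

lemma power_add_ge_add_power:
  fixes x y :: real
  assumes "x \<ge> 0" "y \<ge> 0" "n > 0"
  shows "x ^ n + y ^ n \<le> (x + y) ^ n"
  using assms(3)
proof (induction n rule: nat_induct_non_zero)
  case (Suc n)
  have "x ^ Suc n + y ^ Suc n \<le> (x + y) * (x ^ n + y ^ n)"
    using assms by (simp add: algebra_simps)
  also have "\<dots> \<le> (x + y) * (x + y) ^ n"
    using Suc assms by (intro mult_left_mono) auto
  finally show ?case by simp
qed simp

text \<open>Follows from superadditivity of the n-th power; later it separates the initial energy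
  from the growing weight under the root.\<close>

lemma root_add_le:
  assumes "n > 0" "a \<ge> 0" "b \<ge> 0"
  shows "root n (a + b) \<le> root n a + root n b"
proof -
  have "a + b \<le> (root n a + root n b) ^ n"
    using power_add_ge_add_power [of "root n a" "root n b" n] assms by simp
  then have "root n (a + b) \<le> root n ((root n a + root n b) ^ n)"
    using assms by (intro real_root_le_mono)
  then show ?thesis
    using assms by (simp add: real_root_power_cancel)
qed

text \<open>The weight integral is the limit at infinity of the profile with source
  \<open>p^k\<close>. Multiplying the source by \<open>c^k\<close> multiplies the profile by
  \<open>c\<close>, and a larger source gives a larger profile.\<close>

lemma rsol_unbounded:
  assumes k: "1 \<le> k" "k \<le> N" and p: "continuous_on {0..} p" "\<And>r. r \<ge> 0 \<Longrightarrow> p r > 0"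
    and w: "weight_integral N k p = \<infinity>"
    and h: "continuous_on {0..} h" "\<And>s. s \<ge> 0 \<Longrightarrow> (p s * c) ^ k \<le> h s" and c: "c > 0"
  obtains T where "T \<ge> 0" "\<And>r. r \<ge> T \<Longrightarrow> rsol N k h r \<ge> Z"
proof -
  let ?C = "real ((N - 1) choose (k - 1))"
  have contk: "continuous_on {0..} (\<lambda>s. p s ^ k)" "continuous_on {0..} (\<lambda>s. (p s * c) ^ k)"
    by (intro continuous_intros p)+
  \<comment> \<open>Since the integral is \<open>t^N\<close> times the average, the factor
    \<open>t^k\<close> left over from \<open>t^N / t^(N-k)\<close> leaves the root as
    \<open>t\<close>.\<close>
  have weight: "root k (real k / t ^ (N - k) * integral {0..t} (\<lambda>s. s ^ (N - 1) / ?C * p s ^ k))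
      = t * slope N k (\<lambda>s. p s ^ k) t" if "t \<ge> 0" for t
  proof (cases "t = 0")
    case False
    with that have t: "t > 0" by simp
    have "integral {0..t} (\<lambda>s. s ^ (N - 1) / ?C * p s ^ k) = integral {0..t} (\<lambda>s. 1 / ?C * (s ^ (N - 1) * p s ^ k))"
      by simp
    also have "\<dots> = 1 / ?C * (t ^ N * avg N (\<lambda>s. p s ^ k) t)"
      using avg_eq [OF _ contk(1) t, of N] k t by (subst integral_mult_right) simp
    finally have I: "integral {0..t} (\<lambda>s. s ^ (N - 1) / ?C * p s ^ k) = \<dots>" .
    have "root k (real k / t ^ (N - k) * integral {0..t} (\<lambda>s. s ^ (N - 1) / ?C * p s ^ k))
        = root k (t ^ k * (real k / ?C * avg N (\<lambda>s. p s ^ k) t))"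
      unfolding I using k t by (simp add: power_diff)
    also have "\<dots> = t * slope N k (\<lambda>s. p s ^ k) t"
      unfolding real_root_mult slope_def using k t by (simp add: real_root_power_cancel)
    finally show ?thesis .
  qed (use k in simp)
  have "(\<integral>\<^sup>+t\<in>{0..}. ennreal (t * slope N k (\<lambda>s. p s ^ k) t) \<partial>lborel) = \<infinity>"
    unfolding w [symmetric] weight_integral_def
  proof (rule nn_integral_cong)
    fix t :: real
    show "ennreal (t * slope N k (\<lambda>s. p s ^ k) t) * indicator {0..} t =
        ennreal (root k (real k / t ^ (N - k) * integral {0..t} (\<lambda>s. s ^ (N - 1) / ?C * p s ^ k))) * indicator {0..} t"
      using weight [of t] by (cases "t \<ge> 0") simp_all
  qed
  moreover have "continuous_on {0..} (\<lambda>t. t * slope N k (\<lambda>s. p s ^ k) t)"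
    by (intro continuous_intros continuous_on_slope contk)
  moreover have "t * slope N k (\<lambda>s. p s ^ k) t \<ge> 0" if "t \<ge> 0" for t
    using that p by (intro mult_nonneg_nonneg slope_nonneg contk) (auto intro: less_imp_le)
  ultimately obtain T where T: "T \<ge> 0" "rsol N k (\<lambda>s. p s ^ k) T > Z / c"
    unfolding rsol_def using integral_unbounded_if_nn_integral_infinite by metis
  have "slope N k (\<lambda>s. (p s * c) ^ k) s = c * slope N k (\<lambda>s. p s ^ k) s" for s
  proof -
    have "avg N (\<lambda>s. (p s * c) ^ k) s = c ^ k * avg N (\<lambda>s. p s ^ k) s"
      unfolding avg_def power_mult_distrib
      by (subst integral_mult_right [symmetric]) (simp add: ac_simps)
    then have "slope N k (\<lambda>s. (p s * c) ^ k) s = root k (c ^ k * (real k / ?C * avg N (\<lambda>s. p s ^ k) s))"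
      by (simp add: slope_def mult.left_commute)
    then show ?thesis
      using k c unfolding slope_def real_root_mult by (simp add: real_root_power_cancel)
  qed
  then have "rsol N k (\<lambda>s. (p s * c) ^ k) T = integral {0..T} (\<lambda>s. c * (s * slope N k (\<lambda>s. p s ^ k) s))"
    unfolding rsol_def by (simp add: mult.left_commute)
  then have "rsol N k (\<lambda>s. (p s * c) ^ k) T = c * rsol N k (\<lambda>s. p s ^ k) T"
    by (simp add: rsol_def)
  also have "\<dots> > Z" using T(2) c by (simp add: field_simps)
  finally have TZ: "rsol N k (\<lambda>s. (p s * c) ^ k) T > Z" .
  have "rsol N k (\<lambda>s. (p s * c) ^ k) T \<le> rsol N k h T"
    by (intro rsol_mono k contk h)
  moreover have hnn: "h s \<ge> 0" if "s \<ge> 0" for s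
  proof -
    have "(p s * c) ^ k \<ge> 0" using p(2) [OF that] c by simp
    with h(2) [OF that] show ?thesis by linarith
  qed
  ultimately have "rsol N k h r \<ge> Z" if "r \<ge> T" for r
    using TZ rsol_mono_arg [OF h(1) hnn that, of N k] by simp
  with T(1) show thesis by (rule that)
qed

section \<open>Integral form of a given solution and its behaviour at infinity\<close>

context
  fixes N k :: nat and p q :: "real \<Rightarrow> real" and f g :: "real \<Rightarrow> real \<Rightarrow> real"
    and u v :: "real ^ 'n::finite \<Rightarrow> real"
  assumes k: "1 \<le> k" "k \<le> N"
    and p: "continuous_on {0..} p" "\<And>r. r \<ge> 0 \<Longrightarrow> p r > 0"
    and q: "continuous_on {0..} q" "\<And>r. r \<ge> 0 \<Longrightarrow> q r > 0"
    and f: "nonlinearity f" and g: "nonlinearity g"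
    and N: "N = CARD('n)"
    and sol: "nonneg_radial_solution k p q f g u v"
begin

text \<open>\<open>U\<close> and \<open>V\<close> are only known to be nonnegative here, so
  positivity of the sources is taken from the cone condition \<open>S_k > 0\<close> together with
  the system. With it \<open>radial_admissible_eq_rsol\<close> applies.\<close>

lemma solution_profile:
  obtains U V where "\<And>x. u x = U (norm x)" "\<And>x. v x = V (norm x)"
    "continuous_on {0..} U" "continuous_on {0..} V"
    "\<And>r. r \<ge> 0 \<Longrightarrow> U r \<ge> 0" "\<And>r. r \<ge> 0 \<Longrightarrow> V r \<ge> 0"
    "\<And>r. r \<ge> 0 \<Longrightarrow> source k p f U V r > 0" "\<And>r. r \<ge> 0 \<Longrightarrow> source k q g U V r > 0"
    "\<And>r. r \<ge> 0 \<Longrightarrow> U r = U 0 + rsol N k (source k p f U V) r"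
    "\<And>r. r \<ge> 0 \<Longrightarrow> V r = V 0 + rsol N k (source k q g U V) r"
proof -
  fix i0 :: 'n
  let ?e = "axis i0 1 :: real ^ 'n"
  define U where "U r = u (r *\<^sub>R ?e)" for r
  define V where "V r = v (r *\<^sub>R ?e)" for r
  have adm: "u \<in> admissible k" "v \<in> admissible k" and rad: "radial u" "radial v"
    and nn: "\<And>x. u x \<ge> 0" "\<And>x. v x \<ge> 0"
    and sys: "\<And>x. root k (elem_sym k (eigenvalue_vector (hessian u x))) = p (norm x) * f (u x) (v x)"
      "\<And>x. root k (elem_sym k (eigenvalue_vector (hessian v x))) = q (norm x) * g (u x) (v x)"
    using sol by (auto simp: nonneg_radial_solution_def hessian_system_def)
  have U: "u x = U (norm x)" for x
    using rad(1)[unfolded radial_def, rule_format, of x "norm x *\<^sub>R ?e"] by (simp add: U_def)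
  have V: "v x = V (norm x)" for x
    using rad(2)[unfolded radial_def, rule_format, of x "norm x *\<^sub>R ?e"] by (simp add: V_def)
  have C2: "continuous_on UNIV w" if "w \<in> C2" for w :: "real ^ 'n \<Rightarrow> real"
    using that by (auto simp: C2_def continuous_on_eq_continuous_at intro: differentiable_imp_continuous_within)
  have contu: "continuous_on UNIV u" "continuous_on UNIV v"
    using adm by (auto simp: admissible_def intro: C2)
  have cont: "continuous_on {0..} U" "continuous_on {0..} V"
    unfolding U_def [abs_def] V_def [abs_def]
    by (intro continuous_on_compose2 [OF contu(1)] continuous_on_compose2 [OF contu(2)] continuous_intros subset_UNIV)+
  have pow: "y = z ^ k" if "root k y = z" "y > 0" for y z
    using that k by auto
  have pos: "elem_sym k (eigenvalue_vector (hessian u x)) > 0" "elem_sym k (eigenvalue_vector (hessian v x)) > 0" for x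
    using adm k by (auto simp: admissible_def Garding_cone_def)
  have es: "elem_sym k (eigenvalue_vector (hessian u x)) = source k p f U V (norm x)"
    "elem_sym k (eigenvalue_vector (hessian v x)) = source k q g U V (norm x)" for x
    using pow [OF sys(1) pos(1), of x] pow [OF sys(2) pos(2), of x] by (simp_all add: source_def U V)
  have spos: "source k p f U V r > 0" "source k q g U V r > 0" if "r \<ge> 0" for r
    using es [of "r *\<^sub>R ?e"] pos [of "r *\<^sub>R ?e"] that by simp_all
  have UVnn: "U r \<ge> 0" "V r \<ge> 0" for r
    using nn by (simp_all add: U_def V_def)
  have scont: "continuous_on {0..} (source k p f U V)" "continuous_on {0..} (source k q g U V)"
    by (rule continuous_on_source [OF p(1) f cont UVnn] continuous_on_source [OF q(1) g cont UVnn])+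
  have "U r = U 0 + rsol N k (source k p f U V) r" if "r \<ge> 0" for r
    using radial_admissible_eq_rsol [OF k scont(1) spos(1) N adm(1) rad(1) es(1), of "r *\<^sub>R ?e"] that
    by (simp add: U_def [of r] U_def [of 0])
  moreover have "V r = V 0 + rsol N k (source k q g U V) r" if "r \<ge> 0" for r
    using radial_admissible_eq_rsol [OF k scont(2) spos(2) N adm(2) rad(2) es(2), of "r *\<^sub>R ?e"] that
    by (simp add: V_def [of r] V_def [of 0])
  ultimately show thesis
    using that [OF U V cont UVnn spos] by blast
qed

text \<open>Both profiles are nondecreasing, so the nonlinearities stay above their values at the
  origin, and each source dominates a constant multiple of the k-th power of its weight.\<close>

lemma large_if_weights_infinite:
  assumes "weight_integral N k p = \<infinity>" "weight_integral N k q = \<infinity>"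
  shows "large u v"
proof -
  obtain U V where U: "\<And>x. u x = U (norm x)" and V: "\<And>x. v x = V (norm x)"
    and cont: "continuous_on {0..} U" "continuous_on {0..} V"
    and nn: "\<And>r. r \<ge> 0 \<Longrightarrow> U r \<ge> 0" "\<And>r. r \<ge> 0 \<Longrightarrow> V r \<ge> 0"
    and spos: "\<And>r. r \<ge> 0 \<Longrightarrow> source k p f U V r > 0" "\<And>r. r \<ge> 0 \<Longrightarrow> source k q g U V r > 0"
    and eq: "\<And>r. r \<ge> 0 \<Longrightarrow> U r = U 0 + rsol N k (source k p f U V) r"
    "\<And>r. r \<ge> 0 \<Longrightarrow> V r = V 0 + rsol N k (source k q g U V) r"
    by (rule solution_profile) (rule that)
  have scont: "continuous_on {0..} (source k p f U V)" "continuous_on {0..} (source k q g U V)"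
    by (rule continuous_on_source [OF p(1) f cont nn] continuous_on_source [OF q(1) g cont nn]; assumption)+
  have ge: "U 0 \<le> U r" "V 0 \<le> V r" if "r \<ge> 0" for r
    using eq [OF that] rsol_nonneg [OF scont(1) less_imp_le [OF spos(1)], of N k r]
      rsol_nonneg [OF scont(2) less_imp_le [OF spos(2)], of N k r] by auto
  define cf where "cf = f (U 0) (V 0)"
  define cg where "cg = g (U 0) (V 0)"
  have c0: "cf \<ge> 0" "cg \<ge> 0"
    unfolding cf_def cg_def
    using nonlinearity_nonneg [OF f nn [of 0]] nonlinearity_nonneg [OF g nn [of 0]] by auto
  \<comment> \<open>The initial values themselves may be 0; strictness comes from positivity of the
    sources at the origin.\<close>
  have c: "cf > 0" "cg > 0"
    using c0 spos [of 0] k by (auto simp: source_def cf_def cg_def less_le power_0_left)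
  have le: "(p s * cf) ^ k \<le> source k p f U V s" "(q s * cg) ^ k \<le> source k q g U V s" if "s \<ge> 0" for s
  proof -
    have "cf \<le> f (U s) (V s)" "cg \<le> g (U s) (V s)"
      unfolding cf_def cg_def
      by (intro nonlinearity_mono [OF f] nonlinearity_mono [OF g] ge that nn order_refl)+
    then show "(p s * cf) ^ k \<le> source k p f U V s" "(q s * cg) ^ k \<le> source k q g U V s"
      unfolding source_def using p(2) [OF that] q(2) [OF that] c0
      by (auto intro!: power_mono mult_left_mono)
  qed
  have "filterlim u at_top at_infinity"
    unfolding filterlim_at_top
  proof
    fix Z
    obtain T where T: "T \<ge> 0" "\<And>r. r \<ge> T \<Longrightarrow> rsol N k (source k p f U V) r \<ge> Z"
      using rsol_unbounded [OF k p assms(1) scont(1) le(1) c(1)] by blast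
    have "u x \<ge> Z" if "norm x \<ge> T" for x
      using T(2) [OF that] eq(1) [of "norm x"] nn(1) [of 0] unfolding U by simp
    then show "\<forall>\<^sub>F x in at_infinity. Z \<le> u x"
      unfolding eventually_at_infinity by blast
  qed
  moreover have "filterlim v at_top at_infinity"
    unfolding filterlim_at_top
  proof
    fix Z
    obtain T where T: "T \<ge> 0" "\<And>r. r \<ge> T \<Longrightarrow> rsol N k (source k q g U V) r \<ge> Z"
      using rsol_unbounded [OF k q assms(2) scont(2) le(2) c(2)] by blast
    have "v x \<ge> Z" if "norm x \<ge> T" for x
      using T(2) [OF that] eq(2) [of "norm x"] nn(2) [of 0] unfolding V by simp
    then show "\<forall>\<^sub>F x in at_infinity. Z \<le> v x"
      unfolding eventually_at_infinity by blast
  qed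
  ultimately show ?thesis by (simp add: large_def)
qed


text \<open>The condition \<open>2 * k < N\<close> means \<open>N/k - 1 > 1\<close>, which makes the
  contribution of the initial energy, of order \<open>r^(1-N/k)\<close>, integrable at
  infinity.\<close>

lemma weight_integral_if_large:
  assumes KO: "keller_osserman_integral k f g = \<infinity>" and large: "large u v" and kN: "2 * k < N" and "\<epsilon> > 0" and R: "R > 0"
    and mono: "mono_on {R..} (\<lambda>r. r powr (real N + real N / real k - 2) * (p r ^ k + q r ^ k))"
  shows "(\<integral>\<^sup>+ t \<in> {0..}. ennreal (t powr (1 + \<epsilon> + 2 * (real k - 1) / (real k + 1)) *
           (p t ^ k + q t ^ k) powr (2 / (real k + 1))) \<partial>lborel) = \<infinity>" (is "?I = \<infinity>")
proof (rule ccontr)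
  assume fin: "?I \<noteq> \<infinity>"
  obtain U V where U: "\<And>x. u x = U (norm x)" and V: "\<And>x. v x = V (norm x)"
    and cont: "continuous_on {0..} U" "continuous_on {0..} V"
    and nn: "\<And>r. r \<ge> 0 \<Longrightarrow> U r \<ge> 0" "\<And>r. r \<ge> 0 \<Longrightarrow> V r \<ge> 0"
    and spos: "\<And>r. r \<ge> 0 \<Longrightarrow> source k p f U V r > 0" "\<And>r. r \<ge> 0 \<Longrightarrow> source k q g U V r > 0"
    and eq: "\<And>r. r \<ge> 0 \<Longrightarrow> U r = U 0 + rsol N k (source k p f U V) r"
    "\<And>r. r \<ge> 0 \<Longrightarrow> V r = V 0 + rsol N k (source k q g U V) r"
    by (rule solution_profile) (rule that)
  let ?X = "source k p f U V" and ?Y = "source k q g U V"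
  have scont: "continuous_on {0..} ?X" "continuous_on {0..} ?Y"
    by (rule continuous_on_source [OF p(1) f cont nn] continuous_on_source [OF q(1) g cont nn]; assumption)+
  let ?G = "KO_root k f g" and ?F = "primitive_F k f g" and ?C = "real ((N - 1) choose (k - 1))"
  have C: "?C > 0" using binom_pred_pos [OF k] .
  define S where "S r = p r ^ k + q r ^ k" for r
  have S: "S r > 0" if "r \<ge> 0" for r
    using p(2) [OF that] q(2) [OF that] by (simp add: S_def add_pos_pos)
  have Scont: "continuous_on {0..} S"
    unfolding S_def [abs_def] by (intro continuous_intros p q)
  define P where "P r = r powr (real N + real N / real k - 2) * S r" for r
  define J where "J r = r powr (1 + \<epsilon> + 2 * (real k - 1) / (real k + 1)) * S r powr (2 / (real k + 1))" for r
  define W where "W r = U 0 + V 0 + rsol N k ?X r + rsol N k ?Y r" for r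
  have W: "W r = U r + V r" if "r \<ge> 0" for r
    using eq [OF that] by (simp add: W_def)
  have Wcont: "continuous_on {0..} W"
    unfolding W_def [abs_def] by (intro continuous_intros continuous_on_rsol scont)
  have dW: "(W has_real_derivative s * slope N k ?X s + s * slope N k ?Y s) (at s)" if "s > 0" for s
    unfolding W_def [abs_def] using rsol_has_derivative_at [OF scont(1) that] rsol_has_derivative_at [OF scont(2) that]
    by (auto intro!: derivative_eq_intros)
  have snn: "s * slope N k ?X s \<ge> 0" "s * slope N k ?Y s \<ge> 0" if "s \<ge> 0" for s
    using mult_nonneg_nonneg [OF that slope_nonneg [OF scont(1) less_imp_le [OF spos(1)] that]]
      mult_nonneg_nonneg [OF that slope_nonneg [OF scont(2) less_imp_le [OF spos(2)] that]] by auto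
  have Wlarge: "\<exists>b. \<forall>r\<ge>b. r \<ge> 0 \<longrightarrow> W r > Z" for Z
  proof -
    obtain b where b: "\<And>x. norm x \<ge> b \<Longrightarrow> u x \<ge> Z + 1"
      using large unfolding large_def filterlim_at_top eventually_at_infinity by blast
    fix i0 :: 'n
    have "W r > Z" if "r \<ge> b" "r \<ge> 0" for r
      using b [of "r *\<^sub>R axis i0 1"] that nn(2) [of r] U [of "r *\<^sub>R axis i0 1"] W [of r] by simp
    then show ?thesis by blast
  qed
  obtain b where b: "\<And>r. r \<ge> b \<Longrightarrow> r \<ge> 0 \<Longrightarrow> W r > 1"
    using Wlarge [of 1] by blast
  \<comment> \<open>Beyond \<open>R\<close> the weight is monotone; beyond \<open>b\<close> the sum
    \<open>W\<close> exceeds 1, where the primitive in \<open>osgood_bound\<close> starts.\<close>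
  define R0 where "R0 = max R b"
  have R0: "R0 > 0" "R0 \<ge> R" using R by (auto simp: R0_def)
  have W1: "W r > 1" if "r \<ge> R0" for r
    using b [of r] that R0 by (simp add: R0_def)
  define \<gamma> where "\<gamma> = real N / real k - 1"
  have \<gamma>: "\<gamma> > 1"
    using kN k by (simp add: \<gamma>_def field_simps)
  \<comment> \<open>With \<open>\<omega> = r^\<gamma>\<close> the factor
    \<open>\<omega>^(k+1) r^(k-1)\<close> of the energy estimate is exactly the power of
    \<open>r\<close> in the monotonicity hypothesis, so \<open>P s \<le> P r\<close>
    applies.\<close>
  have \<gamma>eq: "\<gamma> * (real k + 1) + (real k - 1) = real N + real N / real k - 2"
    using k by (simp add: \<gamma>_def field_simps)
  define e where "e h = (R0 powr \<gamma> * (R0 * slope N k h R0)) ^ (k + 1)" for h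
  have e: "e ?X \<ge> 0" "e ?Y \<ge> 0"
    unfolding e_def using snn [of R0] R0 by auto
  have F1: "?F 1 > 0" using F_pos [OF f g] by simp
  \<comment> \<open>Since \<open>F (W r) \<ge> F 1\<close>, the energies at \<open>R0\<close> are
    absorbed into a multiple \<open>D\<close> of \<open>F (W r)\<close>.\<close>
  define D where "D = (e ?X + e ?Y) / (real (k + 1) * ?F 1)"
  have D: "D \<ge> 0" using e F1 by (simp add: D_def)
  have energy: "(r powr \<gamma> * (r * slope N k h r)) ^ (k + 1) \<le> (D + P r / ?C) * (real (k + 1) * ?F (W r))"
    if h: "h \<in> {?X, ?Y}" and r: "r \<ge> R0" for h r
  proof -
    have "(r powr \<gamma> * (r * slope N k h r)) ^ (k + 1) \<le>
        (R0 powr \<gamma> * (R0 * slope N k h R0)) ^ (k + 1) + P r / ?C * (real (k + 1) * ?F (W r))"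
    proof (rule growth_estimate [where \<omega> = "\<lambda>r. r powr \<gamma>" and \<omega>' = "\<lambda>r. \<gamma> * r powr (\<gamma> - 1)", OF f g k])
      show "continuous_on {R0..r} W"
        using Wcont by (rule continuous_on_subset) (use R0 in auto)
      show "(W has_real_derivative s * slope N k ?X s + s * slope N k ?Y s) (at s)" if "s \<in> {R0<..<r}" for s
        using dW that R0 by simp
      show "s * slope N k h s \<le> s * slope N k ?X s + s * slope N k ?Y s" if "s \<in> {R0<..<r}" for s
        using snn [of s] that h R0 by auto
      show "0 < W s" if "s \<in> {R0..r}" for s using W1 [of s] that by simp
      show "0 < h s" if "0 \<le> s" for s using spos [OF that] h by auto
      show "continuous_on {0..} h" using scont h by auto
      show "0 \<le> P r / ?C" using S [of r] R0 r C by (simp add: P_def)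
      show "((\<lambda>r. r powr \<gamma>) has_real_derivative \<gamma> * s powr (\<gamma> - 1)) (at s)" if "s \<in> {R0<..<r}" for s
        using that R0 by (auto intro!: derivative_eq_intros)
      show "s * (\<gamma> * s powr (\<gamma> - 1)) \<le> (real N / real k - 1) * s powr \<gamma>" if "s \<in> {R0<..<r}" for s
        using that R0 powr_mult_base [of s "\<gamma> - 1"] unfolding \<gamma>_def [symmetric] by (simp add: mult.left_commute)
      show "continuous_on {R0..r} (\<lambda>r. r powr \<gamma>)"
        using R0 by (intro continuous_on_powr continuous_on_id continuous_on_const) auto
      show "1 / ?C * (s powr \<gamma>) ^ (k + 1) * s ^ (k - 1) * h s \<le> P r / ?C * diag k f g (W s)"
        if "s \<in> {R0<..<r}" for s
      proof -
        have s: "s > 0" using that R0 by simp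
        have "(s powr \<gamma>) ^ (k + 1) * s ^ (k - 1) = s powr (\<gamma> * (real k + 1)) * s powr (real k - 1)"
          using s k by (simp add: powr_powr of_nat_diff distrib_left powr_add flip: powr_realpow)
        also have "\<dots> = s powr (real N + real N / real k - 2)"
          by (simp add: powr_add [symmetric] \<gamma>eq)
        finally have pow: "(s powr \<gamma>) ^ (k + 1) * s ^ (k - 1) = s powr (real N + real N / real k - 2)" .
        have "h s \<le> S s * diag k f g (W s)"
          using source_le_diag [OF k p q f g, of s U V] nn [of s] s h W [of s] by (auto simp: S_def)
        then have "s powr (real N + real N / real k - 2) * h s \<le> P s * diag k f g (W s)"
          unfolding P_def mult.assoc by (intro mult_left_mono) auto
        also have "\<dots> \<le> P r * diag k f g (W s)"
        proof (rule mult_right_mono)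
          show "P s \<le> P r"
            using mono_onD [OF mono, of s r] that R0 r unfolding P_def S_def by simp
          show "diag k f g (W s) \<ge> 0"
            using W1 [of s] that by (intro diag_nonneg [OF f g]) simp
        qed
        finally have "1 / ?C * (s powr (real N + real N / real k - 2) * h s) \<le> 1 / ?C * (P r * diag k f g (W s))"
          using C by (intro mult_left_mono) auto
        then show ?thesis
          unfolding pow [symmetric] by (simp add: mult.assoc)
      qed
    qed (use R0 r in auto)
    also have "(R0 powr \<gamma> * (R0 * slope N k h R0)) ^ (k + 1) \<le> e ?X + e ?Y"
      using h e unfolding e_def by auto
    also have "e ?X + e ?Y = D * (real (k + 1) * ?F 1)"
      using F1 by (simp add: D_def)
    also have "\<dots> \<le> D * (real (k + 1) * ?F (W r))"
      using W1 [OF r] D by (intro mult_left_mono F_mono [OF f g]) auto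
    finally show ?thesis by (simp add: algebra_simps)
  qed
  define d where "d = root (k + 1) D"
  define c where "c = root (k + 1) (1 / ?C)"
  have cd: "c \<ge> 0" "d \<ge> 0" using C D by (simp_all add: c_def d_def)
  \<comment> \<open>The factor 2 in front of \<open>d\<close> counts the two components; in the
    second term it has been used up by \<open>2 x y \<le> x^2 + y^2\<close>.\<close>
  define \<theta> where "\<theta> r = 2 * d * r powr (- \<gamma>) + c * (r powr (- \<epsilon> - 1) + J r)" for r
  have slope_le: "r * slope N k h r \<le> \<theta> r / 2 * ?G (W r)" if h: "h \<in> {?X, ?Y}" and r: "r \<ge> R0" for h r
  proof -
    have r0: "r > 0" using r R0 by simp
    have Pnn: "P r \<ge> 0" using S [of r] r0 by (simp add: P_def)
    have G: "?G (W r) \<ge> 0" using KO_root_pos [OF f g, of "W r" k] W1 [OF r] by simp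
    have "r powr \<gamma> * (r * slope N k h r) \<le> root (k + 1) ((D + P r / ?C) * (real (k + 1) * ?F (W r)))"
      using snn [of r] r0 h by (intro le_root_if_power_le energy [OF h r]) auto
    also have "\<dots> = root (k + 1) (D + P r / ?C) * ?G (W r)"
      by (simp only: real_root_mult KO_root_def [OF f g])
    also have "\<dots> \<le> (d + c * root (k + 1) (P r)) * ?G (W r)"
    proof (rule mult_right_mono [OF _ G])
      have "root (k + 1) (D + P r / ?C) \<le> root (k + 1) D + root (k + 1) (1 / ?C * P r)"
        using root_add_le [of "k + 1" D "P r / ?C"] D Pnn C by simp
      then show "root (k + 1) (D + P r / ?C) \<le> d + c * root (k + 1) (P r)"
        by (simp only: real_root_mult c_def d_def)
    qed
    finally have "r powr (- \<gamma>) * (r powr \<gamma> * (r * slope N k h r)) \<le>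
        r powr (- \<gamma>) * ((d + c * root (k + 1) (P r)) * ?G (W r))"
      by (rule mult_left_mono) simp
    then have "r * slope N k h r \<le> (d * r powr (- \<gamma>) + c * (r powr (- \<gamma>) * root (k + 1) (P r))) * ?G (W r)"
      using r0 by (simp add: powr_minus field_simps)
    also have "\<dots> \<le> \<theta> r / 2 * ?G (W r)"
    proof (rule mult_right_mono [OF _ G])
      \<comment> \<open>The factor to be estimated is \<open>r^((k-1)/(k+1)) S^(1/(k+1))\<close>. It
        is split so that \<open>x^2 = r^(-1-\<epsilon>)\<close> is integrable at infinity and
        \<open>y^2\<close> is the integrand \<open>J\<close> of the first alternative; hence the
        role of \<open>\<epsilon>\<close> and the exponents in \<open>J\<close>.\<close>
      define x where "x = r powr (- (1 + \<epsilon>) / 2)"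
      define y where "y = r powr ((1 + \<epsilon>) / 2 + (real k - 1) / (real k + 1)) * S r powr (1 / (real k + 1))"
      have "root (k + 1) (P r) = P r powr (1 / (real k + 1))"
        using S [of r] r0 by (simp add: root_powr_inverse P_def inverse_eq_divide add.commute)
      also have "\<dots> = r powr ((real N + real N / real k - 2) / (real k + 1)) * S r powr (1 / (real k + 1))"
        using S [of r] r0 by (simp add: P_def powr_mult powr_powr)
      also have "(real N + real N / real k - 2) / (real k + 1) = \<gamma> + (real k - 1) / (real k + 1)"
        unfolding \<gamma>eq [symmetric] by (simp add: field_simps)
      finally have "r powr (- \<gamma>) * root (k + 1) (P r) = r powr ((real k - 1) / (real k + 1)) * S r powr (1 / (real k + 1))"
        using r0 by (simp add: powr_add powr_minus)
      also have "\<dots> = x * y"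
      proof -
        have "- (1 + \<epsilon>) / 2 + ((1 + \<epsilon>) / 2 + (real k - 1) / (real k + 1)) = (real k - 1) / (real k + 1)"
          by linarith
        then show ?thesis
          unfolding x_def y_def mult.assoc [symmetric] powr_add [symmetric] by (simp only:)
      qed
      finally have xy: "r powr (- \<gamma>) * root (k + 1) (P r) = x * y" .
      have "x\<^sup>2 = r powr (- \<epsilon> - 1)"
      proof -
        have "- (1 + \<epsilon>) / 2 + - (1 + \<epsilon>) / 2 = - \<epsilon> - 1"
          by (simp add: field_simps)
        then show ?thesis
          unfolding x_def power2_eq_square powr_add [symmetric] by (simp only:)
      qed
      moreover have "y\<^sup>2 = J r"
      proof -
        have "y\<^sup>2 = (r powr ((1 + \<epsilon>) / 2 + (real k - 1) / (real k + 1)) * r powr ((1 + \<epsilon>) / 2 + (real k - 1) / (real k + 1))) *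
            (S r powr (1 / (real k + 1)) * S r powr (1 / (real k + 1)))"
          by (simp only: y_def power2_eq_square mult_ac)
        moreover have "(1 + \<epsilon>) / 2 + (real k - 1) / (real k + 1) + ((1 + \<epsilon>) / 2 + (real k - 1) / (real k + 1)) =
            1 + \<epsilon> + 2 * (real k - 1) / (real k + 1)"
        proof -
          have "(1 + \<epsilon>) / 2 + a + ((1 + \<epsilon>) / 2 + a) = 1 + \<epsilon> + 2 * a" for a
            by (simp add: field_simps)
          then show ?thesis
            unfolding times_divide_eq_right [symmetric] .
        qed
        moreover have "1 / (real k + 1) + 1 / (real k + 1) = 2 / (real k + 1)"
          by simp
        ultimately show ?thesis
          unfolding J_def powr_add [symmetric] by (simp only:)
      qed
      ultimately have "2 * (r powr (- \<gamma>) * root (k + 1) (P r)) \<le> r powr (- \<epsilon> - 1) + J r"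
        using sum_squares_bound [of x y] unfolding xy by simp
      from mult_left_mono [OF this cd(1)]
      show "d * r powr (- \<gamma>) + c * (r powr (- \<gamma>) * root (k + 1) (P r)) \<le> \<theta> r / 2"
        by (simp add: \<theta>_def)
    qed
    finally show ?thesis .
  qed
  have S0: "S r \<noteq> 0" if "r \<ge> R0" for r
    using S [of r] R0 that by simp
  have Jcont: "continuous_on {R0..} J"
    unfolding J_def [abs_def] using R0 S0
    by (intro continuous_on_mult continuous_on_powr continuous_on_id continuous_on_const
        continuous_on_subset [OF Scont]) auto
  have Jnn: "J r \<ge> 0" for r by (simp add: J_def)
  have "(\<integral>\<^sup>+ t \<in> {R0..}. ennreal (J t) \<partial>lborel) \<le> ?I"
    unfolding J_def S_def using R0 by (intro nn_integral_mono) (auto split: split_indicator)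
  also have "\<dots> < \<infinity>" using fin by (simp add: less_top)
  finally obtain M where M: "\<And>T. T \<ge> R0 \<Longrightarrow> integral {R0..T} J \<le> M"
    using integral_bounded_if_nn_integral_finite [OF Jcont Jnn] by blast
  \<comment> \<open>A primitive of \<open>\<theta>\<close>. Its two explicit terms are nonpositive
    since \<open>\<gamma> > 1\<close> and \<open>\<epsilon> > 0\<close>, so it is bounded above by
    \<open>c M\<close>.\<close>
  define \<Theta> where "\<Theta> r = 2 * d * (r powr (1 - \<gamma>) / (1 - \<gamma>)) + c * (- (r powr (- \<epsilon>) / \<epsilon>) + integral {R0..r} J)" for r
  have d\<Theta>: "(\<Theta> has_real_derivative \<theta> r) (at r)" if "r > R0" for r
    unfolding \<Theta>_def [abs_def] \<theta>_def
    using that R0 \<gamma> \<open>\<epsilon> > 0\<close> integral_has_real_derivative_at [OF Jcont that]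
    by (auto intro!: derivative_eq_intros)
  have \<Theta>cont: "continuous_on {R0..} \<Theta>"
    unfolding \<Theta>_def [abs_def] using R0 \<gamma> \<open>\<epsilon> > 0\<close>
    by (intro continuous_intros continuous_on_powr continuous_on_id continuous_on_const
        DERIV_continuous_on [OF integral_has_real_derivative_atLeast [OF Jcont]]) auto
  have \<Theta>_le: "\<Theta> r - \<Theta> R0 \<le> c * M - \<Theta> R0" if "r \<ge> R0" for r
  proof -
    have "r powr (1 - \<gamma>) / (1 - \<gamma>) \<le> 0"
      using \<gamma> by (intro divide_nonneg_neg) auto
    then have "2 * d * (r powr (1 - \<gamma>) / (1 - \<gamma>)) \<le> 0"
      using cd(2) by (intro mult_nonneg_nonpos) auto
    moreover have "- (r powr (- \<epsilon>) / \<epsilon>) + integral {R0..r} J \<le> M"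
      using M [OF that] divide_nonneg_pos [OF powr_ge_zero \<open>\<epsilon> > 0\<close>, of r "- \<epsilon>"] by linarith
    from mult_left_mono [OF this cd(1)]
    have "c * (- (r powr (- \<epsilon>) / \<epsilon>) + integral {R0..r} J) \<le> c * M" .
    ultimately show ?thesis by (simp add: \<Theta>_def [of r])
  qed
  obtain T where T: "integral {1..T} (\<lambda>t. 1 / ?G t) > integral {1..W R0} (\<lambda>t. 1 / ?G t) + (c * M - \<Theta> R0)"
    using KO_integral_unbounded [OF f g KO] .
  have "W r \<le> T" if r: "r \<ge> R0" for r
  proof (rule osgood_bound [OF continuous_on_KO_root [OF f g] _ r])
    show "?G t > 0" if "t \<ge> 1" for t
      using KO_root_pos [OF f g] that by simp
    show "continuous_on {R0..r} W"
      using Wcont by (rule continuous_on_subset) (use R0 in auto)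
    show "continuous_on {R0..r} \<Theta>"
      using \<Theta>cont by (rule continuous_on_subset) auto
    show "1 < W s" if "s \<in> {R0..r}" for s using W1 that by simp
    show "(W has_real_derivative s * slope N k ?X s + s * slope N k ?Y s) (at s)" if "s \<in> {R0<..<r}" for s
      using dW that R0 by simp
    show "(\<Theta> has_real_derivative \<theta> s) (at s)" if "s \<in> {R0<..<r}" for s
      using d\<Theta> that by simp
    show "s * slope N k ?X s + s * slope N k ?Y s \<le> \<theta> s * ?G (W s)" if "s \<in> {R0<..<r}" for s
      using slope_le [of ?X s] slope_le [of ?Y s] that by simp
    show "integral {1..W R0} (\<lambda>t. 1 / ?G t) + \<Theta> r - \<Theta> R0 < integral {1..T} (\<lambda>t. 1 / ?G t)"
      using T \<Theta>_le [OF r] by simp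
  qed
  moreover obtain b' where "\<And>r. r \<ge> b' \<Longrightarrow> r \<ge> 0 \<Longrightarrow> W r > T"
    using Wlarge [of T] by blast
  ultimately show False
    using R0 by (metis less_imp_le linorder_not_less max.cobounded1 max.cobounded2 order_trans)
qed

end

theorem theorem4:
  fixes k :: nat
    and p q :: "real \<Rightarrow> real"
    and f g :: "real \<Rightarrow> real \<Rightarrow> real"
    and N :: nat
  assumes N_eq: "N = CARD('n::finite)"
    and N_ge: "N \<ge> 3"
    and k: "k \<in> {1..N}"
    and p: "continuous_on {0..} p" "\<forall>r\<ge>0. p r > 0"
    and q: "continuous_on {0..} q" "\<forall>r\<ge>0. q r > 0"
    and f: "nonlinearity f"
    and g: "nonlinearity g"
    and KO: "keller_osserman_integral k f g = \<infinity>"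
  shows
    "(\<exists>(u :: real ^ 'n \<Rightarrow> real) v. nonneg_radial_solution k p q f g u v \<and> nontrivial u v) \<and>
     ((\<exists>R>0. mono_on {R..}
         (\<lambda>r. r powr (real N + real N / real k - 2) * (p r ^ k + q r ^ k))) \<longrightarrow>
        (weight_integral N k p = \<infinity> \<and> weight_integral N k q = \<infinity> \<longrightarrow>
          (\<forall>(u :: real ^ 'n \<Rightarrow> real) v.
             nonneg_radial_solution k p q f g u v \<and> nontrivial u v \<longrightarrow> large u v)) \<and>
        ((\<exists>(u :: real ^ 'n \<Rightarrow> real) v. nonneg_radial_solution k p q f g u v \<and> large u v) \<longrightarrow>
          (\<forall>\<epsilon>>0. (\<integral>\<^sup>+ t \<in> {0..}.
              ennreal (t powr (1 + \<epsilon> + 2 * (real k - 1) / (real k + 1)) *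
                (p t ^ k + q t ^ k) powr (2 / (real k + 1))) \<partial>lborel) = \<infinity>) \<or>
          (odd N \<and> k \<in> {N div 2 + 1..N} \<or> even N \<and> k \<in> {N div 2..N})))"
proof -
  have k': "1 \<le> k" "k \<le> N" using k by auto
  have p': "\<And>r. r \<ge> 0 \<Longrightarrow> p r > 0" and q': "\<And>r. r \<ge> 0 \<Longrightarrow> q r > 0"
    using p(2) q(2) by auto
  note data = k' p(1) p' q(1) q' f g
  let ?alt = "odd N \<and> k \<in> {N div 2 + 1..N} \<or> even N \<and> k \<in> {N div 2..N}"
  have "\<exists>(u :: real ^ 'n \<Rightarrow> real) v. nonneg_radial_solution k p q f g u v \<and> nontrivial u v"
    by (rule exists_solution [OF data N_eq KO])
  moreover have "large u v"
    if "weight_integral N k p = \<infinity>" "weight_integral N k q = \<infinity>" "nonneg_radial_solution k p q f g u v"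
    for u v :: "real ^ 'n \<Rightarrow> real"
    by (rule large_if_weights_infinite [OF data N_eq that(3,1,2)])
  moreover have "(\<integral>\<^sup>+ t \<in> {0..}. ennreal (t powr (1 + \<epsilon> + 2 * (real k - 1) / (real k + 1)) *
      (p t ^ k + q t ^ k) powr (2 / (real k + 1))) \<partial>lborel) = \<infinity>"
    if "R > 0" "mono_on {R..} (\<lambda>r. r powr (real N + real N / real k - 2) * (p r ^ k + q r ^ k))"
      "nonneg_radial_solution k p q f g u v" "large u v" "\<not> ?alt" "\<epsilon> > 0"
    for u v :: "real ^ 'n \<Rightarrow> real" and R \<epsilon> :: real
  proof -
    \<comment> \<open>The second alternative fails exactly when \<open>2 k < N\<close>: for odd
      \<open>N\<close> it leaves \<open>k \<le> (N - 1)/2\<close>, for even \<open>N\<close> it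
      leaves \<open>k < N/2\<close>.\<close>
    have "2 * k < N"
      using \<open>\<not> ?alt\<close> k' by (cases "even N") (auto elim!: evenE oddE)
    from weight_integral_if_large [OF data N_eq that(3) KO that(4) this that(6,1,2)] show ?thesis .
  qed
  ultimately show ?thesis by blast
qed

end
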